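(* Let $p,q>1$ and $0<\rho<1$ with $\frac1p+\frac1q=\rho+1$, and let $r,r'>1$ with $\frac1r+\frac1{r'}+\rho=2$. Let $\phi\in L^1(\mathbb{R})$, $\psi\in L^p(\mathbb{R})$, $\chi\in L^q(\mathbb{R})$, where $\phi\in L^2(\mathbb{R})$ satisfies $0<C_\phi=\int_{\mathbb{R}}\frac{|\hat\phi(\omega)|^2}{|\omega|}\,d\omega<\infty$, and let $h\in L^r(\mathbb{R})$, $g\in L^{r'}(\mathbb{R})$. Then $$\|h\,\#^\alpha g\|_1\le C_\phi^{-1}\,C(\rho,p,r)\,\|\phi\|_1\,\|\psi\|_p\,\|\chi\|_q\,\|g\|_{r'}\,\|h\|_r ,$$ where $C(\rho,p,r)$ is a constant depending only on $\rho,p,r$.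
   Context: Let $\theta=\alpha\pi/2$ with $\sin\theta\ne 0$. For a function $f$ on $\mathbb{R}$ (with $f=\phi,\psi,\chi$), $a\in\mathbb{R}\setminus\{0\}$, $b\in\mathbb{R}$, put $$f^{\alpha}_{a,b}(t)=e^{-\frac{i}{2}(t^2-b^2)\cot\theta}\,|a|^{-\rho}\,f\!\left(\frac{t-b}{a}\right).$$ The basic function associated with $(\phi,\psi,\chi)$ is $$D^\alpha(u,v,w)=C_\phi^{-1}\int_{\mathbb{R}}\int_{\mathbb{R}}\overline{\psi^\alpha_{a,b}(w)}\;\overline{\chi^\alpha_{a,b}(v)}\;\phi^\alpha_{a,b}(u)\,|a|^{2\rho-3}\,da\,db ,$$ and the associated convolution is $$(h\,\#^\alpha g)(u)=\int_{\mathbb{R}}\int_{\mathbb{R}}D^\alpha(u,v,w)\,h(w)\,g(v)\,dv\,dw .$$ The Fourier transform is $\hat\phi(\omega)=\int_{\mathbb{R}}\phi(t)e^{-i\omega t}\,dt$. Note that $r'$ is not the Hölder conjugate of $r$. *)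

theory Defs
  imports "HOL-Analysis.Analysis"
begin

definition Lp_space :: "real \<Rightarrow> (real \<Rightarrow> complex) set" where
  "Lp_space p = {f. f \<in> borel_measurable lebesgue \<and>
                    integrable lebesgue (\<lambda>x. norm (f x) powr p)}"

text \<open>Only meaningful for members of \<^const>\<open>Lp_space\<close>: the Bochner integral is \<open>0\<close>
  when it does not converge.\<close>

definition Lp_norm :: "real \<Rightarrow> (real \<Rightarrow> complex) \<Rightarrow> real" where
  "Lp_norm p f = (LINT x|lebesgue. norm (f x) powr p) powr (1 / p)"

definition fourier :: "(real \<Rightarrow> complex) \<Rightarrow> real \<Rightarrow> complex" where
  "fourier f \<omega> = (LINT t|lebesgue. f t * exp (- \<i> * of_real (\<omega> * t)))"

definition admissibility_const :: "(real \<Rightarrow> complex) \<Rightarrow> real" where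
  "admissibility_const \<phi> = (LINT \<omega>|lebesgue. (norm (fourier \<phi> \<omega>))\<^sup>2 / \<bar>\<omega>\<bar>)"

definition admissible :: "(real \<Rightarrow> complex) \<Rightarrow> bool" where
  "admissible \<phi> \<longleftrightarrow>
     \<phi> \<in> Lp_space 2 \<and>
     integrable lebesgue (\<lambda>\<omega>. (norm (fourier \<phi> \<omega>))\<^sup>2 / \<bar>\<omega>\<bar>) \<and>
     0 < admissibility_const \<phi>"

text \<open>The triple \<open>(\<phi>, \<psi>, chi)\<close> is written \<open>(\<phi>, \<psi>, \<eta>)\<close>, since the letter chi is a
  reserved binder. The atom \<open>f\<^sup>\<alpha>\<^sub>a\<^sub>,\<^sub>b\<close> is intended for \<open>a \<noteq> 0\<close>; for \<open>a = 0\<close> the definition below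
  yields \<open>0\<close>, which the integrals over \<open>a\<close> do not see.\<close>

definition atom :: "real \<Rightarrow> real \<Rightarrow> (real \<Rightarrow> complex) \<Rightarrow> real \<Rightarrow> real \<Rightarrow> real \<Rightarrow> complex" where
  "atom \<alpha> \<rho> f a b t =
     exp (- (\<i> / 2) * of_real ((t\<^sup>2 - b\<^sup>2) * cot (\<alpha> * pi / 2)))
     * of_real (\<bar>a\<bar> powr (- \<rho>)) * f ((t - b) / a)"

definition basic_integrand ::
  "real \<Rightarrow> real \<Rightarrow> (real \<Rightarrow> complex) \<Rightarrow> (real \<Rightarrow> complex) \<Rightarrow> (real \<Rightarrow> complex)
   \<Rightarrow> real \<Rightarrow> real \<Rightarrow> real \<Rightarrow> real \<Rightarrow> real \<Rightarrow> complex" where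
  "basic_integrand \<alpha> \<rho> \<phi> \<psi> \<eta> u v w a b =
     cnj (atom \<alpha> \<rho> \<psi> a b w) * cnj (atom \<alpha> \<rho> \<eta> a b v) * atom \<alpha> \<rho> \<phi> a b u
     * of_real (\<bar>a\<bar> powr (2 * \<rho> - 3))"

definition basic_fun ::
  "real \<Rightarrow> real \<Rightarrow> (real \<Rightarrow> complex) \<Rightarrow> (real \<Rightarrow> complex) \<Rightarrow> (real \<Rightarrow> complex)
   \<Rightarrow> real \<Rightarrow> real \<Rightarrow> real \<Rightarrow> complex" where
  "basic_fun \<alpha> \<rho> \<phi> \<psi> \<eta> u v w =
     of_real (inverse (admissibility_const \<phi>))
     * (LINT b|lebesgue. LINT a|lebesgue. basic_integrand \<alpha> \<rho> \<phi> \<psi> \<eta> u v w a b)"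

definition wconv ::
  "real \<Rightarrow> real \<Rightarrow> (real \<Rightarrow> complex) \<Rightarrow> (real \<Rightarrow> complex) \<Rightarrow> (real \<Rightarrow> complex)
   \<Rightarrow> (real \<Rightarrow> complex) \<Rightarrow> (real \<Rightarrow> complex) \<Rightarrow> real \<Rightarrow> complex" where
  "wconv \<alpha> \<rho> \<phi> \<psi> \<eta> h g u =
     (LINT w|lebesgue. LINT v|lebesgue. basic_fun \<alpha> \<rho> \<phi> \<psi> \<eta> u v w * h w * g v)"

text \<open>The integrals defining the convolution at \<open>u\<close> converge absolutely, as integrals over
  the plane: the outer one, and the one defining the basic function at almost every
  \<open>(v, w)\<close>. Without this the values above could be default values of divergent
  Bochner integrals; with it, Fubini's theorem makes the order of integration immaterial.\<close>

definition wconv_converges ::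
  "real \<Rightarrow> real \<Rightarrow> (real \<Rightarrow> complex) \<Rightarrow> (real \<Rightarrow> complex) \<Rightarrow> (real \<Rightarrow> complex)
   \<Rightarrow> (real \<Rightarrow> complex) \<Rightarrow> (real \<Rightarrow> complex) \<Rightarrow> real \<Rightarrow> bool" where
  "wconv_converges \<alpha> \<rho> \<phi> \<psi> \<eta> h g u \<longleftrightarrow>
     (AE (v, w) in lebesgue.
        integrable lebesgue (\<lambda>(a, b). basic_integrand \<alpha> \<rho> \<phi> \<psi> \<eta> u v w a b)) \<and>
     integrable lebesgue (\<lambda>(v, w). basic_fun \<alpha> \<rho> \<phi> \<psi> \<eta> u v w * h w * g v)"

end

theory Submission
  imports Defs
begin

text \<open>Integrating the modulus of the integrand over \<open>u\<close> first yields \<open>\<bar>a\<bar> \<parallel>\<phi>\<parallel>\<^sub>1\<close>. The substitution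
  \<open>x = (w - b) / a\<close>, \<open>y = (v - b) / a\<close> then turns the integral over \<open>a, b\<close> into
  \<open>\<bar>w - v\<bar> powr (- \<rho>)\<close> times the double integral of \<open>\<bar>\<psi> x\<bar> \<bar>\<eta> y\<bar> \<bar>x - y\<bar> powr (\<rho> - 1)\<close>, so the five-fold
  integral factors into \<open>\<parallel>\<phi>\<parallel>\<^sub>1\<close> and two Hardy-Littlewood-Sobolev forms: for \<open>(\<psi>, \<eta>)\<close> with kernel exponent
  \<open>1 - \<rho>\<close> and for \<open>(h, g)\<close> with kernel exponent \<open>\<rho>\<close>.\<close>

section \<open>The Hardy-Littlewood-Sobolev inequality on the line\<close>

text \<open>All estimates are carried out in \<open>ennreal\<close>, where Tonelli asks for
  measurability only; convergence is then read off from finiteness. The two relations between the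
  exponents are exactly the scaling conditions of the two Hardy-Littlewood-Sobolev forms. That
  inequality is proved by a direct truncation, without maximal functions or interpolation. For fixed
  x the function g is cut at the level where g^q = f(x)^p; this level makes f(x) times the truncated
  potential bounded by a multiple of f(x)^p, which can be integrated. The complementary part is the
  same situation with f and g exchanged. A second obstacle is measurability: the data are Lebesgue
  measurable, while the product arguments are made for Borel functions. The data enter through f((t
  - b) / a) under iterated integrals, so passing to Borel representatives requires that these maps
  pull null sets back to null sets, both in a for fixed b and jointly in (a, b).\<close>

lemma nn_integral_abs:
  fixes F :: "real \<Rightarrow> ennreal"
  assumes [measurable]: "F \<in> borel_measurable borel"
  shows "(\<integral>\<^sup>+t. F \<bar>t\<bar> \<partial>lborel) = 2 * (\<integral>\<^sup>+t. F t * indicator {0..} t \<partial>lborel)"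
proof -
  have "(\<integral>\<^sup>+t. F \<bar>t\<bar> \<partial>lborel)
      = (\<integral>\<^sup>+t. F \<bar>t\<bar> * indicator {0..} t + F \<bar>t\<bar> * indicator {..<0} t \<partial>lborel)"
    by (intro nn_integral_cong) (auto simp: indicator_def)
  also have "\<dots> = (\<integral>\<^sup>+t. F \<bar>t\<bar> * indicator {0..} t \<partial>lborel)
      + (\<integral>\<^sup>+t. F \<bar>t\<bar> * indicator {..<0} t \<partial>lborel)"
    by (rule nn_integral_add) auto
  also have "(\<integral>\<^sup>+t. F \<bar>t\<bar> * indicator {0..} t \<partial>lborel)
      = (\<integral>\<^sup>+t. F t * indicator {0..} t \<partial>lborel)"
    by (intro nn_integral_cong) (auto simp: indicator_def)
  also have "(\<integral>\<^sup>+t. F \<bar>t\<bar> * indicator {..<0} t \<partial>lborel)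
      = (\<integral>\<^sup>+t. F \<bar>t\<bar> * indicator {0<..} t \<partial>lborel)"
    by (subst nn_integral_real_affine[of _ "-1" 0]) (auto simp: indicator_def intro!: nn_integral_cong)
  also have "\<dots> = (\<integral>\<^sup>+t. F t * indicator {0..} t \<partial>lborel)"
    by (intro nn_integral_cong_AE AE_I[of _ _ "{0}"]) (auto simp: indicator_def)
  finally show ?thesis by (simp add: mult_2)
qed

lemma nn_integral_abs_powr_near_0:
  fixes \<kappa> R :: real
  assumes "\<kappa> < 1" "0 \<le> R"
  shows "(\<integral>\<^sup>+t. ennreal (\<bar>t\<bar> powr (- \<kappa>)) * indicator {0..R} \<bar>t\<bar> \<partial>lborel)
    = ennreal (2 / (1 - \<kappa>) * R powr (1 - \<kappa>))"
proof -
  have "(\<integral>\<^sup>+t. ennreal (\<bar>t\<bar> powr (- \<kappa>)) * indicator {0..R} \<bar>t\<bar> \<partial>lborel)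
      = 2 * (\<integral>\<^sup>+t. (ennreal (t powr (- \<kappa>)) * indicator {0..R} t) * indicator {0..} t \<partial>lborel)"
    by (rule nn_integral_abs) measurable
  also have "(\<integral>\<^sup>+t. (ennreal (t powr (- \<kappa>)) * indicator {0..R} t) * indicator {0..} t \<partial>lborel)
      = (\<integral>\<^sup>+t. ennreal (t powr (- \<kappa>)) * indicator {0..R} t \<partial>lborel)"
    by (intro nn_integral_cong) (auto simp: indicator_def)
  also have "\<dots> = ennreal (R powr (- \<kappa> + 1) / (- \<kappa> + 1))"
    using assms by (intro nn_integral_has_integral_lebesgue' has_integral_powr_from_0) auto
  also have "2 * \<dots> = ennreal (2 / (1 - \<kappa>) * R powr (1 - \<kappa>))"
    using assms by (simp add: ennreal_mult' flip: ennreal_numeral)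
      (simp add: field_simps flip: ennreal_mult' ennreal_numeral)
  finally show ?thesis .
qed

lemma nn_integral_abs_powr_at_top:
  fixes \<mu> R :: real
  assumes "1 < \<mu>" "0 < R"
  shows "(\<integral>\<^sup>+t. ennreal (\<bar>t\<bar> powr (- \<mu>)) * indicator {R..} \<bar>t\<bar> \<partial>lborel)
    = ennreal (2 / (\<mu> - 1) * R powr (1 - \<mu>))"
proof -
  have "(\<integral>\<^sup>+t. ennreal (\<bar>t\<bar> powr (- \<mu>)) * indicator {R..} \<bar>t\<bar> \<partial>lborel)
      = 2 * (\<integral>\<^sup>+t. (ennreal (t powr (- \<mu>)) * indicator {R..} t) * indicator {0..} t \<partial>lborel)"
    by (rule nn_integral_abs) measurable
  also have "(\<integral>\<^sup>+t. (ennreal (t powr (- \<mu>)) * indicator {R..} t) * indicator {0..} t \<partial>lborel)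
      = (\<integral>\<^sup>+t. ennreal (t powr (- \<mu>)) * indicator {R..} t \<partial>lborel)"
    using assms by (intro nn_integral_cong) (auto simp: indicator_def)
  also have "\<dots> = ennreal (- (R powr (- \<mu> + 1)) / (- \<mu> + 1))"
    using assms by (intro nn_integral_has_integral_lebesgue' has_integral_powr_to_inf) auto
  also have "- (R powr (- \<mu> + 1)) / (- \<mu> + 1) = R powr (1 - \<mu>) / (\<mu> - 1)"
    using assms by (simp add: divide_simps) (simp add: algebra_simps)
  also have "2 * ennreal (R powr (1 - \<mu>) / (\<mu> - 1)) = ennreal (2 * (R powr (1 - \<mu>) / (\<mu> - 1)))"
    using assms by (subst ennreal_mult) auto
  finally show ?thesis by simp
qed

section \<open>Truncated potentials\<close>

text \<open>Young's inequality with a free scale s and without the sharp constants. At x = s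
  z^(1/(q-1)) the product and both terms on the right coincide; on either side of this threshold one
  of the two terms alone dominates the product.\<close>

lemma mult_le_weighted_powr:
  fixes x z s q :: real
  assumes "1 < q" "0 \<le> x" "0 \<le> z" "0 < s"
  shows "x * z \<le> s powr (1 - q) * x powr q + s * z powr (q / (q - 1))"
proof (cases "x = 0 \<or> z = 0")
  case True
  then show ?thesis using assms by auto
next
  case False
  with assms have x: "0 < x" and z: "0 < z" by auto
  show ?thesis
  proof (cases "s * z powr (1 / (q - 1)) \<le> x")
    case True
    then have "z powr (1 / (q - 1)) \<le> x / s"
      using assms by (simp add: field_simps)
    then have "(z powr (1 / (q - 1))) powr (q - 1) \<le> (x / s) powr (q - 1)"
      using assms by (intro powr_mono2) auto
    moreover have "(z powr (1 / (q - 1))) powr (q - 1) = z"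
      using assms z by (simp add: powr_powr)
    moreover have "(x / s) powr (q - 1) = x powr (q - 1) * s powr (1 - q)"
      using assms powr_minus_divide[of s "q - 1"] by (simp add: powr_divide)
    ultimately have "z \<le> x powr (q - 1) * s powr (1 - q)" by simp
    then have "x * z \<le> x * (x powr (q - 1) * s powr (1 - q))"
      using x by (intro mult_left_mono) auto
    also have "\<dots> = s powr (1 - q) * x powr q"
      using x by (simp add: powr_diff)
    finally show ?thesis using assms by (simp add: add_increasing2)
  next
    case False
    then have "x * z \<le> s * z powr (1 / (q - 1)) * z"
      using z by (intro mult_right_mono) auto
    also have "\<dots> = s * z powr (1 / (q - 1) + 1)"
      using z by (simp add: powr_add)
    also have "1 / (q - 1) + 1 = q / (q - 1)"
      using assms by (simp add: field_simps)
    finally show ?thesis using assms by (simp add: add_increasing)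
  qed
qed

text \<open>The summands are the contributions of the kernel near its singularity, of the L^q mass
  of g in Young's inequality, and of the tail of the kernel raised to the power q / (q - 1).\<close>

definition trunc_const :: "real \<Rightarrow> real \<Rightarrow> real" where
  "trunc_const \<kappa> q = 2 / (1 - \<kappa>) + 1 + 2 / (\<kappa> * q / (q - 1) - 1)"

lemma truncated_potential_bound:
  fixes g :: "real \<Rightarrow> real"
  assumes [measurable]: "g \<in> borel_measurable borel" and g: "\<And>y. 0 \<le> g y"
    and norm: "(\<integral>\<^sup>+y. ennreal (g y powr q) \<partial>lborel) \<le> 1"
    and \<kappa>: "0 < \<kappa>" "\<kappa> < 1" and q: "1 < q" "q * (1 - \<kappa>) < 1" and T: "0 < T"
  shows "(\<integral>\<^sup>+y. ennreal (g y * \<bar>x - y\<bar> powr (- \<kappa>)) * indicator {y. g y \<le> T} y \<partial>lborel)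
    \<le> ennreal (trunc_const \<kappa> q * T powr (1 - q * (1 - \<kappa>)))"
proof -
  \<comment> \<open>Use \<open>g \<le> T\<close> for \<open>\<bar>x - y\<bar> \<le> R\<close> and weighted Young beyond; the scales \<open>R\<close> and \<open>s\<close> are chosen so
    that all three resulting terms are multiples of \<open>T powr \<gamma>\<close>.\<close>
  define \<gamma> where "\<gamma> = 1 - q * (1 - \<kappa>)"
  define \<mu> where "\<mu> = \<kappa> * q / (q - 1)"
  define R where "R = T powr (- q)"
  define s where "s = T powr (- \<gamma> / (q - 1))"
  have R: "0 < R" and s: "0 < s" using T by (auto simp: R_def s_def)
  \<comment> \<open>Equivalent to q (1 - \<kappa>) < 1: the tail of the kernel, raised to the
    conjugate exponent of q, is integrable.\<close>
  have \<mu>: "1 < \<mu>" using q by (simp add: \<mu>_def field_simps)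
  have e1: "T * R powr (1 - \<kappa>) = T powr \<gamma>"
  proof -
    have "T * R powr (1 - \<kappa>) = T powr 1 * T powr (- q * (1 - \<kappa>))"
      using T by (simp add: R_def powr_powr)
    also have "\<dots> = T powr (1 + - q * (1 - \<kappa>))" by (rule powr_add[symmetric])
    also have "1 + - q * (1 - \<kappa>) = \<gamma>" by (simp add: \<gamma>_def)
    finally show ?thesis .
  qed
  have e2: "s powr (1 - q) = T powr \<gamma>"
  proof -
    have "- \<gamma> / (q - 1) * (1 - q) = \<gamma>"
      using q by (simp add: divide_simps) (simp add: algebra_simps)
    then show ?thesis by (simp add: s_def powr_powr)
  qed
  \<comment> \<open>The first two identities already fix \<open>R\<close> and \<open>s\<close>; the
    third balance is then automatic because \<mu> - 1 = \<gamma> / (q - 1).\<close>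
  have e3: "s * R powr (1 - \<mu>) = T powr \<gamma>"
  proof -
    have "- \<gamma> / (q - 1) + - q * (1 - \<mu>) = \<gamma>"
      using q by (simp add: \<gamma>_def \<mu>_def divide_simps) algebra
    then show ?thesis by (simp add: s_def R_def powr_powr flip: powr_add)
  qed
  let ?n = "\<lambda>y. ennreal (\<bar>x - y\<bar> powr (- \<kappa>)) * indicator {0..R} \<bar>x - y\<bar>"
  let ?f = "\<lambda>y. ennreal (\<bar>x - y\<bar> powr (- \<mu>)) * indicator {R..} \<bar>x - y\<bar>"
  have "(\<integral>\<^sup>+y. ennreal (g y * \<bar>x - y\<bar> powr (- \<kappa>)) * indicator {y. g y \<le> T} y \<partial>lborel)
     \<le> (\<integral>\<^sup>+y. ennreal T * ?n y + (ennreal (s powr (1 - q)) * ennreal (g y powr q)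
         + ennreal s * ?f y) \<partial>lborel)"
  proof (intro nn_integral_mono)
    fix y
    show "ennreal (g y * \<bar>x - y\<bar> powr (- \<kappa>)) * indicator {y. g y \<le> T} y
       \<le> ennreal T * ?n y + (ennreal (s powr (1 - q)) * ennreal (g y powr q) + ennreal s * ?f y)"
    proof (cases "g y \<le> T")
      case gT: True
      show ?thesis
      proof (cases "\<bar>x - y\<bar> \<le> R")
        case True
        have "g y * \<bar>x - y\<bar> powr (- \<kappa>) \<le> T * \<bar>x - y\<bar> powr (- \<kappa>)"
          using gT by (intro mult_right_mono) auto
        then show ?thesis using True gT T
          by (intro add_increasing2) (auto simp flip: ennreal_mult' intro!: ennreal_leI)
      next
        case False
        have "(\<bar>x - y\<bar> powr (- \<kappa>)) powr (q / (q - 1)) = \<bar>x - y\<bar> powr (- \<mu>)"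
          by (simp add: powr_powr \<mu>_def)
        then have "g y * \<bar>x - y\<bar> powr (- \<kappa>)
            \<le> s powr (1 - q) * g y powr q + s * \<bar>x - y\<bar> powr (- \<mu>)"
          using mult_le_weighted_powr[of q "g y" "\<bar>x - y\<bar> powr (- \<kappa>)" s] q g s by simp
        then show ?thesis using False gT s
          by (auto simp flip: ennreal_mult' ennreal_plus intro!: ennreal_leI)
      qed
    qed simp
  qed
  also have "\<dots> = ennreal T * (\<integral>\<^sup>+y. ?n y \<partial>lborel)
      + (ennreal (s powr (1 - q)) * (\<integral>\<^sup>+y. ennreal (g y powr q) \<partial>lborel)
         + ennreal s * (\<integral>\<^sup>+y. ?f y \<partial>lborel))"
    by (simp add: nn_integral_add nn_integral_cmult)
  also have "(\<integral>\<^sup>+y. ?n y \<partial>lborel)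
      = (\<integral>\<^sup>+t. ennreal (\<bar>t\<bar> powr (- \<kappa>)) * indicator {0..R} \<bar>t\<bar> \<partial>lborel)"
    by (subst nn_integral_real_affine[of _ "-1" x]) auto
  also have "\<dots> = ennreal (2 / (1 - \<kappa>) * R powr (1 - \<kappa>))"
    using \<kappa> R by (intro nn_integral_abs_powr_near_0) auto
  also have "(\<integral>\<^sup>+y. ?f y \<partial>lborel)
      = (\<integral>\<^sup>+t. ennreal (\<bar>t\<bar> powr (- \<mu>)) * indicator {R..} \<bar>t\<bar> \<partial>lborel)"
    by (subst nn_integral_real_affine[of _ "-1" x]) auto
  also have "\<dots> = ennreal (2 / (\<mu> - 1) * R powr (1 - \<mu>))"
    using \<mu> R by (intro nn_integral_abs_powr_at_top) auto
  also have "ennreal T * ennreal (2 / (1 - \<kappa>) * R powr (1 - \<kappa>))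
      + (ennreal (s powr (1 - q)) * (\<integral>\<^sup>+y. ennreal (g y powr q) \<partial>lborel)
         + ennreal s * ennreal (2 / (\<mu> - 1) * R powr (1 - \<mu>)))
     \<le> ennreal T * ennreal (2 / (1 - \<kappa>) * R powr (1 - \<kappa>))
      + (ennreal (s powr (1 - q)) * 1
         + ennreal s * ennreal (2 / (\<mu> - 1) * R powr (1 - \<mu>)))"
    by (intro add_mono mult_left_mono norm) auto
  also have "\<dots> = ennreal (2 / (1 - \<kappa>) * (T * R powr (1 - \<kappa>)) + (s powr (1 - q)
      + 2 / (\<mu> - 1) * (s * R powr (1 - \<mu>))))"
    using \<kappa> \<mu> T s by (simp add: ennreal_plus mult_ac flip: ennreal_mult')
  also have "2 / (1 - \<kappa>) * (T * R powr (1 - \<kappa>)) + (s powr (1 - q)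
      + 2 / (\<mu> - 1) * (s * R powr (1 - \<mu>))) = trunc_const \<kappa> q * T powr (1 - q * (1 - \<kappa>))"
    unfolding e1 e2 e3 trunc_const_def \<mu>_def[symmetric] \<gamma>_def[symmetric] by (simp add: algebra_simps)
  finally show ?thesis .
qed


lemma trunc_const_nonneg:
  assumes "1 < q" "\<kappa> < 1" "q * (1 - \<kappa>) < 1"
  shows "0 \<le> trunc_const \<kappa> q"
proof -
  have "1 < \<kappa> * q / (q - 1)" using assms by (simp add: field_simps)
  then show ?thesis using assms by (auto simp: trunc_const_def)
qed

text \<open>Since p > 1, the number 1 - \<kappa> = 1/p + 1/q - 1 is smaller than 1/q. The relation
  is symmetric, so the same bound is available with p and q exchanged.\<close>

lemma hls_exponent:
  fixes p q \<kappa> :: real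
  assumes "1 < p" "1 < q" "1 / p + 1 / q + \<kappa> = 2"
  shows "q * (1 - \<kappa>) < 1"
proof -
  have \<kappa>: "\<kappa> = 2 - 1 / p - 1 / q" using assms by simp
  show ?thesis using assms(1,2) unfolding \<kappa> by (simp add: divide_simps)
qed

text \<open>The threshold T = f(x)^(p/q) is the level at which g^q = f(x)^p. With it the bound for
  the truncated potential, multiplied by f(x), becomes a multiple of f(x)^p, and integrating over x
  leaves only the normalization of f.\<close>

lemma hls_half:
  fixes f g :: "real \<Rightarrow> real"
  assumes [measurable]: "f \<in> borel_measurable borel" "g \<in> borel_measurable borel"
    and f: "\<And>x. 0 \<le> f x" and g: "\<And>y. 0 \<le> g y"
    and norm: "(\<integral>\<^sup>+x. ennreal (f x powr p) \<partial>lborel) \<le> 1" "(\<integral>\<^sup>+y. ennreal (g y powr q) \<partial>lborel) \<le> 1"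
    and pq: "1 < p" "1 < q" and \<kappa>: "0 < \<kappa>" "\<kappa> < 1" and eq: "1 / p + 1 / q + \<kappa> = 2"
  shows "(\<integral>\<^sup>+x. \<integral>\<^sup>+y. ennreal (f x * g y * \<bar>x - y\<bar> powr (- \<kappa>))
            * indicator {y. g y \<le> f x powr (p / q)} y \<partial>lborel \<partial>lborel) \<le> ennreal (trunc_const \<kappa> q)"
proof -
  have \<kappa>': "\<kappa> = 2 - 1 / p - 1 / q" using eq by simp
  have q1: "q * (1 - \<kappa>) < 1" using hls_exponent[OF pq eq] .
  \<comment> \<open>The scaling relation in the form needed here: f(x) T^(1 - q (1 - \<kappa>)) has
    total exponent p in f(x).\<close>
  have ex: "1 + (p / q) * (1 - q * (1 - \<kappa>)) = p"
    using pq unfolding \<kappa>' by (simp add: divide_simps) (simp add: algebra_simps)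
  have c: "0 \<le> trunc_const \<kappa> q" using trunc_const_nonneg pq \<kappa> q1 by blast
  have "(\<integral>\<^sup>+x. \<integral>\<^sup>+y. ennreal (f x * g y * \<bar>x - y\<bar> powr (- \<kappa>))
            * indicator {y. g y \<le> f x powr (p / q)} y \<partial>lborel \<partial>lborel)
      \<le> (\<integral>\<^sup>+x. ennreal (trunc_const \<kappa> q) * ennreal (f x powr p) \<partial>lborel)"
  proof (intro nn_integral_mono)
    fix x
    show "(\<integral>\<^sup>+y. ennreal (f x * g y * \<bar>x - y\<bar> powr (- \<kappa>))
            * indicator {y. g y \<le> f x powr (p / q)} y \<partial>lborel)
        \<le> ennreal (trunc_const \<kappa> q) * ennreal (f x powr p)"
    \<comment> \<open>\<open>truncated_potential_bound\<close> needs a positive threshold; where f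
      vanishes, both sides are 0.\<close>
    proof (cases "f x = 0")
      case False
      with f[of x] have fx: "0 < f x" by simp
      define T where "T = f x powr (p / q)"
      have T: "0 < T" using fx by (simp add: T_def)
      have "f x * T powr (1 - q * (1 - \<kappa>)) = f x powr 1 * f x powr ((p / q) * (1 - q * (1 - \<kappa>)))"
        using fx by (simp add: T_def powr_powr)
      also have "\<dots> = f x powr (1 + (p / q) * (1 - q * (1 - \<kappa>)))"
        by (rule powr_add[symmetric])
      finally have pw: "f x * T powr (1 - q * (1 - \<kappa>)) = f x powr p" by (simp only: ex)
      have "(\<integral>\<^sup>+y. ennreal (f x * g y * \<bar>x - y\<bar> powr (- \<kappa>)) * indicator {y. g y \<le> T} y \<partial>lborel)
         = (\<integral>\<^sup>+y. ennreal (f x) * (ennreal (g y * \<bar>x - y\<bar> powr (- \<kappa>)) * indicator {y. g y \<le> T} y) \<partial>lborel)"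
        using fx by (intro nn_integral_cong) (simp add: mult.assoc ennreal_mult')
      also have "\<dots> = ennreal (f x) * (\<integral>\<^sup>+y. ennreal (g y * \<bar>x - y\<bar> powr (- \<kappa>)) * indicator {y. g y \<le> T} y \<partial>lborel)"
        by (rule nn_integral_cmult) measurable
      also have "\<dots> \<le> ennreal (f x) * ennreal (trunc_const \<kappa> q * T powr (1 - q * (1 - \<kappa>)))"
        by (intro mult_left_mono truncated_potential_bound) (use assms q1 T in auto)
      also have "\<dots> = ennreal (trunc_const \<kappa> q * (f x * T powr (1 - q * (1 - \<kappa>))))"
        using fx c by (simp add: mult_ac flip: ennreal_mult')
      also have "\<dots> = ennreal (trunc_const \<kappa> q) * ennreal (f x powr p)"
        using c by (simp add: pw ennreal_mult')
      finally show ?thesis by (simp add: T_def)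
    qed simp
  qed
  also have "\<dots> = ennreal (trunc_const \<kappa> q) * (\<integral>\<^sup>+x. ennreal (f x powr p) \<partial>lborel)"
    by (rule nn_integral_cmult) measurable
  also have "\<dots> \<le> ennreal (trunc_const \<kappa> q) * 1"
    by (intro mult_left_mono norm) auto
  finally show ?thesis by simp
qed

section \<open>The full inequality from its two halves\<close>

definition hls_const :: "real \<Rightarrow> real \<Rightarrow> real \<Rightarrow> real" where
  "hls_const \<kappa> p q = trunc_const \<kappa> p + trunc_const \<kappa> q"

lemma hls_const_nonneg:
  assumes "1 < p" "1 < q" "\<kappa> < 1" "1 / p + 1 / q + \<kappa> = 2"
  shows "0 \<le> hls_const \<kappa> p q"
  using trunc_const_nonneg[of q \<kappa>] trunc_const_nonneg[of p \<kappa>]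
    hls_exponent[of p q \<kappa>] hls_exponent[of q p \<kappa>] assms
  by (simp add: hls_const_def)

lemma hls_normalized:
  fixes f g :: "real \<Rightarrow> real"
  assumes [measurable]: "f \<in> borel_measurable borel" "g \<in> borel_measurable borel"
    and f: "\<And>x. 0 \<le> f x" and g: "\<And>y. 0 \<le> g y"
    and norm: "(\<integral>\<^sup>+x. ennreal (f x powr p) \<partial>lborel) \<le> 1" "(\<integral>\<^sup>+y. ennreal (g y powr q) \<partial>lborel) \<le> 1"
    and pq: "1 < p" "1 < q" and \<kappa>: "0 < \<kappa>" "\<kappa> < 1" and eq: "1 / p + 1 / q + \<kappa> = 2"
  shows "(\<integral>\<^sup>+x. \<integral>\<^sup>+y. ennreal (f x * g y * \<bar>x - y\<bar> powr (- \<kappa>)) \<partial>lborel \<partial>lborel)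
    \<le> ennreal (hls_const \<kappa> p q)"
proof -
  \<comment> \<open>Split the plane according to whether \<open>g y powr q \<le> f x powr p\<close>; the two parts are symmetric.\<close>
  let ?A = "\<lambda>x y. ennreal (f x * g y * \<bar>x - y\<bar> powr (- \<kappa>)) * indicator {y. g y \<le> f x powr (p / q)} y"
  let ?B = "\<lambda>x y. ennreal (g y * f x * \<bar>y - x\<bar> powr (- \<kappa>)) * indicator {x. f x \<le> g y powr (q / p)} x"
  have split: "ennreal (f x * g y * \<bar>x - y\<bar> powr (- \<kappa>)) \<le> ?A x y + ?B x y" for x y
  proof (cases "g y \<le> f x powr (p / q)")
    case False
    then have "(f x powr (p / q)) powr (q / p) \<le> g y powr (q / p)"
      using pq by (intro powr_mono2) auto
    then have "f x \<le> g y powr (q / p)" using pq f[of x] by (simp add: powr_powr)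
    then show ?thesis by (simp add: mult.commute abs_minus_commute add_increasing)
  qed simp
  have "(\<integral>\<^sup>+x. \<integral>\<^sup>+y. ennreal (f x * g y * \<bar>x - y\<bar> powr (- \<kappa>)) \<partial>lborel \<partial>lborel)
      \<le> (\<integral>\<^sup>+x. \<integral>\<^sup>+y. ?A x y + ?B x y \<partial>lborel \<partial>lborel)"
    by (intro nn_integral_mono split)
  also have "\<dots> = (\<integral>\<^sup>+x. \<integral>\<^sup>+y. ?A x y \<partial>lborel \<partial>lborel) + (\<integral>\<^sup>+x. \<integral>\<^sup>+y. ?B x y \<partial>lborel \<partial>lborel)"
    by (simp add: nn_integral_add)
  \<comment> \<open>Exchanging the order of integration gives the second part the shape of
    \<open>hls_half\<close> with (f, p) and (g, q) swapped.\<close>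
  also have "(\<integral>\<^sup>+x. \<integral>\<^sup>+y. ?B x y \<partial>lborel \<partial>lborel) = (\<integral>\<^sup>+y. \<integral>\<^sup>+x. ?B x y \<partial>lborel \<partial>lborel)"
    by (intro lborel_pair.Fubini') measurable
  also have "(\<integral>\<^sup>+x. \<integral>\<^sup>+y. ?A x y \<partial>lborel \<partial>lborel) + (\<integral>\<^sup>+y. \<integral>\<^sup>+x. ?B x y \<partial>lborel \<partial>lborel)
      \<le> ennreal (trunc_const \<kappa> q) + ennreal (trunc_const \<kappa> p)"
    by (intro add_mono hls_half) (use assms in auto)
  also have "\<dots> = ennreal (hls_const \<kappa> p q)"
    using trunc_const_nonneg[of q \<kappa>] trunc_const_nonneg[of p \<kappa>]
      hls_exponent[of p q \<kappa>] hls_exponent[of q p \<kappa>] assms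
    by (simp add: hls_const_def ennreal_plus add.commute)
  finally show ?thesis .
qed

text \<open>Both sides are homogeneous of degree one in f and in g, so unit norms suffice. A zero
  norm cannot be rescaled, but then that function vanishes almost everywhere and the double integral
  is 0.\<close>

lemma hardy_littlewood_sobolev:
  fixes f g :: "real \<Rightarrow> real"
  assumes [measurable]: "f \<in> borel_measurable borel" "g \<in> borel_measurable borel"
    and f: "\<And>x. 0 \<le> f x" and g: "\<And>y. 0 \<le> g y"
    and int: "integrable lborel (\<lambda>x. f x powr p)" "integrable lborel (\<lambda>x. g x powr q)"
    and pq: "1 < p" "1 < q" and \<kappa>: "0 < \<kappa>" "\<kappa> < 1" and eq: "1 / p + 1 / q + \<kappa> = 2"
  shows "(\<integral>\<^sup>+x. \<integral>\<^sup>+y. ennreal (f x * g y * \<bar>x - y\<bar> powr (- \<kappa>)) \<partial>lborel \<partial>lborel)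
    \<le> ennreal (hls_const \<kappa> p q * (LINT x|lborel. f x powr p) powr (1 / p)
        * (LINT x|lborel. g x powr q) powr (1 / q))"
proof -
  define A where "A = (LINT x|lborel. f x powr p)"
  define B where "B = (LINT x|lborel. g x powr q)"
  have nn: "0 \<le> A" "0 \<le> B" by (auto simp: A_def B_def)
  have fA: "(\<integral>\<^sup>+x. ennreal (f x powr p) \<partial>lborel) = ennreal A"
    unfolding A_def by (intro nn_integral_eq_integral int) auto
  have gB: "(\<integral>\<^sup>+x. ennreal (g x powr q) \<partial>lborel) = ennreal B"
    unfolding B_def by (intro nn_integral_eq_integral int) auto
  show ?thesis
  proof (cases "A = 0 \<or> B = 0")
    case True
    then have "(AE x in lborel. f x = 0) \<or> (AE y in lborel. g y = 0)"
      using fA gB pq by (auto simp: nn_integral_0_iff_AE)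
    then have "(\<integral>\<^sup>+x. \<integral>\<^sup>+y. ennreal (f x * g y * \<bar>x - y\<bar> powr (- \<kappa>)) \<partial>lborel \<partial>lborel) = 0"
    proof
      assume "AE x in lborel. f x = 0"
      then show ?thesis by (auto simp: nn_integral_0_iff_AE)
    next
      assume "AE y in lborel. g y = 0"
      then have "(\<integral>\<^sup>+y. ennreal (f x * g y * \<bar>x - y\<bar> powr (- \<kappa>)) \<partial>lborel) = 0" for x
        by (subst nn_integral_0_iff_AE) auto
      then show ?thesis by simp
    qed
    then show ?thesis by simp
  next
    case False
    with nn have AB: "0 < A" "0 < B" by auto
    define a where "a = A powr (1 / p)"
    define b where "b = B powr (1 / q)"
    have ab: "0 < a" "0 < b" using AB by (auto simp: a_def b_def)
    have a: "a powr p = A" and b: "b powr q = B"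
      using AB pq by (auto simp: a_def b_def powr_powr)
    have "(\<integral>\<^sup>+x. ennreal ((f x / a) powr p) \<partial>lborel) = (\<integral>\<^sup>+x. ennreal (1 / A) * ennreal (f x powr p) \<partial>lborel)"
      using ab AB f by (intro nn_integral_cong) (simp add: powr_divide a flip: ennreal_mult')
    also have "\<dots> = ennreal (1 / A) * ennreal A"
      by (simp add: nn_integral_cmult fA)
    finally have na: "(\<integral>\<^sup>+x. ennreal ((f x / a) powr p) \<partial>lborel) \<le> 1"
      using AB by (simp flip: ennreal_mult')
    have "(\<integral>\<^sup>+x. ennreal ((g x / b) powr q) \<partial>lborel) = (\<integral>\<^sup>+x. ennreal (1 / B) * ennreal (g x powr q) \<partial>lborel)"
      using ab AB g by (intro nn_integral_cong) (simp add: powr_divide b flip: ennreal_mult')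
    also have "\<dots> = ennreal (1 / B) * ennreal B"
      by (simp add: nn_integral_cmult gB)
    finally have nb: "(\<integral>\<^sup>+x. ennreal ((g x / b) powr q) \<partial>lborel) \<le> 1"
      using AB by (simp flip: ennreal_mult')
    have "(\<integral>\<^sup>+x. \<integral>\<^sup>+y. ennreal (f x * g y * \<bar>x - y\<bar> powr (- \<kappa>)) \<partial>lborel \<partial>lborel)
       = (\<integral>\<^sup>+x. \<integral>\<^sup>+y. ennreal (a * b) * ennreal (f x / a * (g y / b) * \<bar>x - y\<bar> powr (- \<kappa>)) \<partial>lborel \<partial>lborel)"
      using ab by (intro nn_integral_cong) (simp flip: ennreal_mult')
    also have "\<dots> = ennreal (a * b) *
        (\<integral>\<^sup>+x. \<integral>\<^sup>+y. ennreal (f x / a * (g y / b) * \<bar>x - y\<bar> powr (- \<kappa>)) \<partial>lborel \<partial>lborel)"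
      by (simp add: nn_integral_cmult)
    also have "\<dots> \<le> ennreal (a * b) * ennreal (hls_const \<kappa> p q)"
      by (intro mult_left_mono hls_normalized na nb) (use assms ab in auto)
    also have "\<dots> = ennreal (hls_const \<kappa> p q * a * b)"
      using ab by (simp add: mult_ac flip: ennreal_mult')
    finally show ?thesis by (simp add: a_def b_def A_def B_def)
  qed
qed

section \<open>The change of variables\<close>

lemma nn_integral_inverse_Icc:
  fixes F :: "real \<Rightarrow> real"
  assumes [measurable]: "F \<in> borel_measurable borel" and ab: "0 < a" "a \<le> 1"
  shows "(\<integral>\<^sup>+x. ennreal (F x) * indicator {a..1 / a} x \<partial>lborel)
    = (\<integral>\<^sup>+x. ennreal (F (1 / x) / x\<^sup>2) * indicator {a..1 / a} x \<partial>lborel)"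
proof -
  have a1: "a \<le> 1 / a" using ab by (smt (verit) le_divide_eq_1)
  \<comment> \<open>The substitution rule is applied to an increasing map, while 1 / x decreases.
    Reflecting first allows the map x -> - (1 / x); the endpoints are written as its values at a and
    1 / a.\<close>
  have "(\<integral>\<^sup>+x. ennreal (F x) * indicator {a..1 / a} x \<partial>lborel)
      = (\<integral>\<^sup>+x. ennreal (F (- x)) * indicator {- (1 / a)..- (1 / (1 / a))} x \<partial>lborel)"
    by (subst nn_integral_real_affine[of _ "-1" 0]) (auto simp: indicator_def intro!: nn_integral_cong)
  also have "\<dots> = (\<integral>\<^sup>+x. ennreal (F (- (- (1 / x))) * (1 / x\<^sup>2)) * indicator {a..1 / a} x \<partial>lborel)"
    unfolding nn_integral_set_ennreal using ab a1
    by (intro nn_integral_substitution)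
      (auto simp: set_borel_measurable_def power2_eq_square intro!: derivative_eq_intros continuous_intros)
  finally show ?thesis by simp
qed

text \<open>The half-line is exhausted by the intervals from 1 / n to n, each of which inversion
  maps onto itself, so both sides are suprema over the same sets.\<close>

lemma nn_integral_inverse_pos:
  fixes F :: "real \<Rightarrow> real"
  assumes [measurable]: "F \<in> borel_measurable borel"
  shows "(\<integral>\<^sup>+x. ennreal (F x) * indicator {0<..} x \<partial>lborel)
    = (\<integral>\<^sup>+x. ennreal (F (1 / x) / x\<^sup>2) * indicator {0<..} x \<partial>lborel)"
proof -
  define I where "I n = {1 / real (Suc n)..1 / (1 / real (Suc n))}" for n
  have [measurable]: "I n \<in> sets borel" for n by (simp add: I_def)
  have inc: "incseq I" 
  proof (intro incseq_SucI)
    fix n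
    have "1 / real (Suc (Suc n)) \<le> 1 / real (Suc n)" by (intro frac_le) auto
    then show "I n \<subseteq> I (Suc n)" unfolding I_def by (auto simp: divide_inverse)
  qed
  have un: "(\<Union>n. I n) = {0<..}"
  proof (intro equalityI subsetI)
    fix x :: real assume "x \<in> {0<..}"
    then have "0 < x" by simp
    then obtain n m where n: "inverse (real (Suc n)) < x" "x < real m"
      using reals_Archimedean reals_Archimedean2 by blast
    have "1 / real (Suc (max n m)) \<le> inverse (real (Suc n))"
      by (simp add: inverse_eq_divide frac_le)
    moreover have "real m \<le> real (Suc (max n m))" by simp
    ultimately have "1 / real (Suc (max n m)) \<le> x" "x \<le> real (Suc (max n m))"
      using n by linarith+
    then show "x \<in> (\<Union>n. I n)" by (auto simp: I_def intro!: exI[of _ "max n m"])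
  next
    fix x assume "x \<in> (\<Union>n. I n)"
    then obtain n where "1 / real (Suc n) \<le> x" by (auto simp: I_def)
    moreover have "0 < 1 / real (Suc n)" by simp
    ultimately show "x \<in> {0<..}" by (simp only: greaterThan_iff)
  qed
  \<comment> \<open>Monotone convergence, read as continuity from below of the measure with density
    \<open>G\<close>.\<close>
  have lim: "(SUP n. \<integral>\<^sup>+x. G x * indicator (I n) x \<partial>lborel) = (\<integral>\<^sup>+x. G x * indicator {0<..} x \<partial>lborel)"
    if [measurable]: "G \<in> borel_measurable borel" for G :: "real \<Rightarrow> ennreal"
    using SUP_emeasure_incseq[of I "density lborel G", OF _ inc]
    by (simp add: un emeasure_density image_subset_iff)
  have "(\<integral>\<^sup>+x. ennreal (F x) * indicator {0<..} x \<partial>lborel)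
      = (SUP n. \<integral>\<^sup>+x. ennreal (F x) * indicator (I n) x \<partial>lborel)"
    by (rule lim[symmetric]) measurable
  also have "\<dots> = (SUP n. \<integral>\<^sup>+x. ennreal (F (1 / x) / x\<^sup>2) * indicator (I n) x \<partial>lborel)"
    unfolding I_def by (intro SUP_cong refl nn_integral_inverse_Icc) auto
  also have "\<dots> = (\<integral>\<^sup>+x. ennreal (F (1 / x) / x\<^sup>2) * indicator {0<..} x \<partial>lborel)"
    by (rule lim) measurable
  finally show ?thesis .
qed

text \<open>Serves twice: for the substitution a = 1 / s in the kernel, and for preimages of null
  sets under x -> c / x.\<close>

lemma nn_integral_inverse:
  fixes F :: "real \<Rightarrow> real"
  assumes [measurable]: "F \<in> borel_measurable borel"
  shows "(\<integral>\<^sup>+x. ennreal (F x) \<partial>lborel) = (\<integral>\<^sup>+x. ennreal (F (1 / x) / x\<^sup>2) \<partial>lborel)"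
proof -
  have split: "(\<integral>\<^sup>+x. ennreal (G x) \<partial>lborel)
      = (\<integral>\<^sup>+x. ennreal (G x) * indicator {0<..} x \<partial>lborel)
      + (\<integral>\<^sup>+x. ennreal (G (- x)) * indicator {0<..} x \<partial>lborel)"
    if [measurable]: "G \<in> borel_measurable borel" for G :: "real \<Rightarrow> real"
  proof -
    have "(\<integral>\<^sup>+x. ennreal (G (- x)) * indicator {0<..} x \<partial>lborel)
        = (\<integral>\<^sup>+x. ennreal (G x) * indicator {..<0} x \<partial>lborel)"
      by (subst nn_integral_real_affine[of _ "-1" 0]) (auto simp: indicator_def intro!: nn_integral_cong)
    moreover have "(\<integral>\<^sup>+x. ennreal (G x) \<partial>lborel)
        = (\<integral>\<^sup>+x. ennreal (G x) * indicator {0<..} x + ennreal (G x) * indicator {..<0} x \<partial>lborel)"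
      by (intro nn_integral_cong_AE AE_I[of _ _ "{0}"]) (auto simp: indicator_def)
    ultimately show ?thesis by (simp add: nn_integral_add)
  qed
  have "(\<integral>\<^sup>+x. ennreal (F (- x)) * indicator {0<..} x \<partial>lborel)
      = (\<integral>\<^sup>+x. ennreal (F (1 / - x) / (- x)\<^sup>2) * indicator {0<..} x \<partial>lborel)"
    using nn_integral_inverse_pos[of "\<lambda>x. F (- x)"] by simp
  moreover have "(\<integral>\<^sup>+x. ennreal (F (1 / x) / x\<^sup>2) \<partial>lborel)
      = (\<integral>\<^sup>+x. ennreal (F (1 / x) / x\<^sup>2) * indicator {0<..} x \<partial>lborel)
      + (\<integral>\<^sup>+x. ennreal (F (1 / - x) / (- x)\<^sup>2) * indicator {0<..} x \<partial>lborel)"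
    by (rule split) measurable
  ultimately show ?thesis
    by (subst split) (simp_all add: nn_integral_inverse_pos[of F])
qed

lemma nn_integral_wavelet_kernel:
  fixes \<Psi> X :: "real \<Rightarrow> real"
  assumes [measurable]: "\<Psi> \<in> borel_measurable borel" "X \<in> borel_measurable borel"
    and nn: "\<And>x. 0 \<le> \<Psi> x" "\<And>x. 0 \<le> X x" and vw: "v \<noteq> w"
  shows "(\<integral>\<^sup>+b. \<integral>\<^sup>+a. ennreal (\<bar>a\<bar> powr (- \<rho> - 2) * \<Psi> ((w - b) / a) * X ((v - b) / a)) \<partial>lborel \<partial>lborel)
    = ennreal (\<bar>w - v\<bar> powr (- \<rho>))
      * (\<integral>\<^sup>+x. \<integral>\<^sup>+y. ennreal (\<Psi> x * X y * \<bar>x - y\<bar> powr (- (1 - \<rho>))) \<partial>lborel \<partial>lborel)"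
proof -
  define c where "c = v - w"
  have c: "c \<noteq> 0" using vw by (simp add: c_def)
  \<comment> \<open>The substitution \<open>x = (w - b) / a\<close>, \<open>y = (v - b) / a\<close>, one variable at a time:
    first \<open>b = w - a * x\<close>, then \<open>a = 1 / s\<close>, then \<open>y = x + c * s\<close>.\<close>
  have inner_b: "(\<integral>\<^sup>+b. ennreal (\<bar>a\<bar> powr (- \<rho> - 2) * \<Psi> ((w - b) / a) * X ((v - b) / a)) \<partial>lborel)
      = (\<integral>\<^sup>+x. ennreal (\<bar>a\<bar> powr (- \<rho> - 1) * \<Psi> x * X (x + c / a)) \<partial>lborel)" for a
  proof (cases "a = 0")
    case False
    have "(\<integral>\<^sup>+b. ennreal (\<bar>a\<bar> powr (- \<rho> - 2) * \<Psi> ((w - b) / a) * X ((v - b) / a)) \<partial>lborel)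
       = ennreal \<bar>-a\<bar> * (\<integral>\<^sup>+x. ennreal (\<bar>a\<bar> powr (- \<rho> - 2) * \<Psi> ((w - (w + - a * x)) / a)
            * X ((v - (w + - a * x)) / a)) \<partial>lborel)"
      using False by (subst nn_integral_real_affine[of _ "-a" w]) auto
    also have "\<dots> = (\<integral>\<^sup>+x. ennreal \<bar>-a\<bar> * ennreal (\<bar>a\<bar> powr (- \<rho> - 2) * \<Psi> ((w - (w + - a * x)) / a)
            * X ((v - (w + - a * x)) / a)) \<partial>lborel)"
      by (rule nn_integral_cmult[symmetric]) measurable
    also have "\<dots> = (\<integral>\<^sup>+x. ennreal (\<bar>a\<bar> powr (- \<rho> - 1) * \<Psi> x * X (x + c / a)) \<partial>lborel)"
    proof (intro nn_integral_cong)
      fix x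
      have 1: "(w - (w + - a * x)) / a = x" "(v - (w + - a * x)) / a = x + c / a"
        using False by (auto simp: c_def field_simps)
      have 2: "\<bar>a\<bar> * \<bar>a\<bar> powr (- \<rho> - 2) = \<bar>a\<bar> powr (- \<rho> - 1)"
      proof -
        have "\<bar>a\<bar> * \<bar>a\<bar> powr (- \<rho> - 2) = \<bar>a\<bar> powr 1 * \<bar>a\<bar> powr (- \<rho> - 2)"
          using False by simp
        also have "\<dots> = \<bar>a\<bar> powr (1 + (- \<rho> - 2))" by (rule powr_add[symmetric])
        also have "1 + (- \<rho> - 2) = - \<rho> - 1" by simp
        finally show ?thesis .
      qed
      show "ennreal \<bar>-a\<bar> * ennreal (\<bar>a\<bar> powr (- \<rho> - 2) * \<Psi> ((w - (w + - a * x)) / a)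
            * X ((v - (w + - a * x)) / a)) = ennreal (\<bar>a\<bar> powr (- \<rho> - 1) * \<Psi> x * X (x + c / a))"
        unfolding 1 by (simp flip: ennreal_mult' 2) (simp add: mult_ac)
    qed
    finally show ?thesis .
  qed simp
  have inner_a: "(\<integral>\<^sup>+a. ennreal (\<bar>a\<bar> powr (- \<rho> - 1) * \<Psi> x * X (x + c / a)) \<partial>lborel)
      = ennreal (\<bar>c\<bar> powr (- \<rho>)) * (\<integral>\<^sup>+y. ennreal (\<Psi> x * X y * \<bar>x - y\<bar> powr (- (1 - \<rho>))) \<partial>lborel)" for x
  proof -
    have "(\<integral>\<^sup>+a. ennreal (\<bar>a\<bar> powr (- \<rho> - 1) * \<Psi> x * X (x + c / a)) \<partial>lborel)
       = (\<integral>\<^sup>+s. ennreal (\<bar>1 / s\<bar> powr (- \<rho> - 1) * \<Psi> x * X (x + c / (1 / s)) / s\<^sup>2) \<partial>lborel)"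
      by (rule nn_integral_inverse) measurable
    also have "\<dots> = (\<integral>\<^sup>+s. (ennreal (\<bar>c\<bar> powr (- \<rho>)) * ennreal \<bar>c\<bar>)
        * ennreal (\<Psi> x * X (x + c * s) * \<bar>x - (x + c * s)\<bar> powr (- (1 - \<rho>))) \<partial>lborel)"
    proof (intro nn_integral_cong)
      fix s
      show "ennreal (\<bar>1 / s\<bar> powr (- \<rho> - 1) * \<Psi> x * X (x + c / (1 / s)) / s\<^sup>2)
        = (ennreal (\<bar>c\<bar> powr (- \<rho>)) * ennreal \<bar>c\<bar>)
        * ennreal (\<Psi> x * X (x + c * s) * \<bar>x - (x + c * s)\<bar> powr (- (1 - \<rho>)))"
      \<comment> \<open>At s = 0 both sides are 0 by the conventions for division by 0 and for 0
        powr a, so the integrands agree at every point.\<close>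
      proof (cases "s = 0")
        case False
        have "\<bar>1 / s\<bar> powr (- \<rho> - 1) / s\<^sup>2 = \<bar>s\<bar> powr (\<rho> + 1) / \<bar>s\<bar> powr 2"
        proof -
          have "\<bar>1 / s\<bar> powr (- \<rho> - 1) = 1 / \<bar>s\<bar> powr (- \<rho> - 1)"
            by (simp add: powr_divide)
          also have "\<dots> = \<bar>s\<bar> powr (- (- \<rho> - 1))" by (rule powr_minus_divide[symmetric])
          also have "- (- \<rho> - 1) = \<rho> + 1" by simp
          finally show ?thesis using False by simp
        qed
        also have "\<dots> = \<bar>s\<bar> powr (\<rho> + 1 - 2)" by (rule powr_diff[symmetric])
        finally have 1: "\<bar>1 / s\<bar> powr (- \<rho> - 1) / s\<^sup>2 = \<bar>s\<bar> powr (- (1 - \<rho>))" by simp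
        \<comment> \<open>With y = x + c s, expressing \<bar>s\<bar>^(\<rho> - 1) through \<bar>x -
          y\<bar> produces \<bar>c\<bar>^(1 - \<rho>). One factor \<bar>c\<bar> is the Jacobian of
          this substitution; \<bar>c\<bar>^(- \<rho>) remains as the kernel for (h, g).\<close>
        have 2: "\<bar>c\<bar> powr (- \<rho>) * \<bar>c\<bar> * \<bar>c * s\<bar> powr (- (1 - \<rho>)) = \<bar>s\<bar> powr (- (1 - \<rho>))"
        proof -
          have "\<bar>c\<bar> powr (- \<rho>) * \<bar>c\<bar> * \<bar>c * s\<bar> powr (- (1 - \<rho>))
            = \<bar>c\<bar> powr (- \<rho>) * \<bar>c\<bar> powr 1 * \<bar>c\<bar> powr (- (1 - \<rho>)) * \<bar>s\<bar> powr (- (1 - \<rho>))"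
            using c by (simp add: abs_mult powr_mult)
          also have "\<bar>c\<bar> powr (- \<rho>) * \<bar>c\<bar> powr 1 * \<bar>c\<bar> powr (- (1 - \<rho>)) = \<bar>c\<bar> powr (- \<rho> + 1 + - (1 - \<rho>))"
            by (simp only: powr_add)
          also have "\<dots> = 1" using c by simp
          finally show ?thesis by simp
        qed
        have "\<bar>1 / s\<bar> powr (- \<rho> - 1) * \<Psi> x * X (x + c / (1 / s)) / s\<^sup>2
          = (\<bar>1 / s\<bar> powr (- \<rho> - 1) / s\<^sup>2) * (\<Psi> x * X (x + c * s))" by simp
        also have "\<dots> = \<bar>c\<bar> powr (- \<rho>) * \<bar>c\<bar>
            * (\<Psi> x * X (x + c * s) * \<bar>x - (x + c * s)\<bar> powr (- (1 - \<rho>)))"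
          unfolding 1 using 2 by (simp add: mult_ac)
        finally show ?thesis using nn by (simp add: ennreal_mult')
      qed simp
    qed
    also have "\<dots> = ennreal (\<bar>c\<bar> powr (- \<rho>)) * (ennreal \<bar>c\<bar> * (\<integral>\<^sup>+s. 
        ennreal (\<Psi> x * X (x + c * s) * \<bar>x - (x + c * s)\<bar> powr (- (1 - \<rho>))) \<partial>lborel))"
      by (subst nn_integral_cmult) (auto simp: mult.assoc)
    also have "ennreal \<bar>c\<bar> * (\<integral>\<^sup>+s. 
        ennreal (\<Psi> x * X (x + c * s) * \<bar>x - (x + c * s)\<bar> powr (- (1 - \<rho>))) \<partial>lborel)
      = (\<integral>\<^sup>+y. ennreal (\<Psi> x * X y * \<bar>x - y\<bar> powr (- (1 - \<rho>))) \<partial>lborel)"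
      by (rule nn_integral_real_affine[symmetric]) (use c in auto)
    finally show ?thesis .
  qed
  have "(\<integral>\<^sup>+b. \<integral>\<^sup>+a. ennreal (\<bar>a\<bar> powr (- \<rho> - 2) * \<Psi> ((w - b) / a) * X ((v - b) / a)) \<partial>lborel \<partial>lborel)
     = (\<integral>\<^sup>+a. \<integral>\<^sup>+b. ennreal (\<bar>a\<bar> powr (- \<rho> - 2) * \<Psi> ((w - b) / a) * X ((v - b) / a)) \<partial>lborel \<partial>lborel)"
    by (rule lborel_pair.Fubini') measurable
  also have "\<dots> = (\<integral>\<^sup>+a. \<integral>\<^sup>+x. ennreal (\<bar>a\<bar> powr (- \<rho> - 1) * \<Psi> x * X (x + c / a)) \<partial>lborel \<partial>lborel)"
    by (simp only: inner_b)
  also have "\<dots> = (\<integral>\<^sup>+x. \<integral>\<^sup>+a. ennreal (\<bar>a\<bar> powr (- \<rho> - 1) * \<Psi> x * X (x + c / a)) \<partial>lborel \<partial>lborel)"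
    by (rule lborel_pair.Fubini') measurable
  also have "\<dots> = ennreal (\<bar>c\<bar> powr (- \<rho>)) * (\<integral>\<^sup>+x. \<integral>\<^sup>+y. ennreal (\<Psi> x * X y * \<bar>x - y\<bar> powr (- (1 - \<rho>))) \<partial>lborel \<partial>lborel)"
    unfolding inner_a by (rule nn_integral_cmult) measurable
  also have "\<bar>c\<bar> = \<bar>w - v\<bar>" by (simp add: c_def abs_minus_commute)
  finally show ?thesis .
qed

section \<open>Estimates for Borel functions\<close>

lemma norm_atom: "norm (atom \<alpha> \<rho> f a b t) = \<bar>a\<bar> powr (- \<rho>) * norm (f ((t - b) / a))"
  by (simp add: atom_def norm_mult)

text \<open>The chirps are unimodular, so \<alpha> disappears from all absolute estimates. The three
  atoms contribute - 3 \<rho> to the exponent of \<bar>a\<bar>, the weight 2 \<rho> - 3.\<close>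

lemma norm_basic_integrand:
  "norm (basic_integrand \<alpha> \<rho> \<phi> \<psi> \<eta> u v w a b)
    = \<bar>a\<bar> powr (- \<rho> - 3) * norm (\<psi> ((w - b) / a)) * norm (\<eta> ((v - b) / a)) * norm (\<phi> ((u - b) / a))"
proof -
  have "\<bar>a\<bar> powr (- \<rho>) * \<bar>a\<bar> powr (- \<rho>) * \<bar>a\<bar> powr (- \<rho>) * \<bar>a\<bar> powr (2 * \<rho> - 3)
      = \<bar>a\<bar> powr (- \<rho> + - \<rho> + - \<rho> + (2 * \<rho> - 3))"
    by (simp only: powr_add)
  also have "- \<rho> + - \<rho> + - \<rho> + (2 * \<rho> - 3) = - \<rho> - 3" by simp
  finally have pw: "\<bar>a\<bar> powr (- \<rho>) * \<bar>a\<bar> powr (- \<rho>) * \<bar>a\<bar> powr (- \<rho>) * \<bar>a\<bar> powr (2 * \<rho> - 3)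
      = \<bar>a\<bar> powr (- \<rho> - 3)" .
  show ?thesis
    by (simp add: basic_integrand_def norm_mult norm_atom flip: pw)
qed

lemma measurable_atom [measurable (raw)]:
  assumes [measurable]: "f \<in> borel_measurable borel"
    "a \<in> borel_measurable M" "b \<in> borel_measurable M" "t \<in> borel_measurable M"
  shows "(\<lambda>x. atom \<alpha> \<rho> f (a x) (b x) (t x)) \<in> borel_measurable M"
  unfolding atom_def by measurable

lemma measurable_basic_integrand [measurable (raw)]:
  assumes [measurable]: "\<phi> \<in> borel_measurable borel" "\<psi> \<in> borel_measurable borel" "\<eta> \<in> borel_measurable borel"
    "u \<in> borel_measurable M" "v \<in> borel_measurable M" "w \<in> borel_measurable M"
    "a \<in> borel_measurable M" "b \<in> borel_measurable M"
  shows "(\<lambda>x. basic_integrand \<alpha> \<rho> \<phi> \<psi> \<eta> (u x) (v x) (w x) (a x) (b x)) \<in> borel_measurable M"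
proof -
  have [measurable]: "cnj \<in> borel_measurable borel"
    by (intro borel_measurable_continuous_onI continuous_intros)
  show ?thesis unfolding basic_integrand_def by measurable
qed

text \<open>A divergent Bochner integral has value 0, so the bound covers that case as well.
  Iterated integrals can thus be estimated before their convergence is known.\<close>

lemma ennreal_norm_integral_le:
  fixes f :: "'a \<Rightarrow> 'b::{banach, second_countable_topology}"
  shows "ennreal (norm (integral\<^sup>L M f)) \<le> (\<integral>\<^sup>+x. ennreal (norm (f x)) \<partial>M)"
  by (cases "integrable M f") (auto intro: integral_norm_bound_ennreal simp: not_integrable_integral_eq)

text \<open>The absolute counterpart of the basic function, without the factor 1 / C_\<phi>. Its
  value may be infinite, which postpones every question of convergence to the finiteness of an
  integral.\<close>

definition abs_basic ::
  "real \<Rightarrow> real \<Rightarrow> (real \<Rightarrow> complex) \<Rightarrow> (real \<Rightarrow> complex) \<Rightarrow> (real \<Rightarrow> complex)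
   \<Rightarrow> real \<Rightarrow> real \<Rightarrow> real \<Rightarrow> ennreal" where
  "abs_basic \<alpha> \<rho> \<phi> \<psi> \<eta> u v w =
     (\<integral>\<^sup>+b. \<integral>\<^sup>+a. ennreal (norm (basic_integrand \<alpha> \<rho> \<phi> \<psi> \<eta> u v w a b)) \<partial>lborel \<partial>lborel)"

section \<open>Absolute bounds for the basic function\<close>

context
  fixes \<alpha> \<rho> :: real and \<phi> \<psi> \<eta> :: "real \<Rightarrow> complex"
  assumes borel [measurable]: "\<phi> \<in> borel_measurable borel" "\<psi> \<in> borel_measurable borel"
    "\<eta> \<in> borel_measurable borel"
begin

lemma measurable_abs_basic [measurable (raw)]:
  assumes [measurable]: "u \<in> borel_measurable M" "v \<in> borel_measurable M" "w \<in> borel_measurable M"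
  shows "(\<lambda>x. abs_basic \<alpha> \<rho> \<phi> \<psi> \<eta> (u x) (v x) (w x)) \<in> borel_measurable M"
  unfolding abs_basic_def by measurable

text \<open>Completion does not change integrals of Borel functions, and over \<open>lborel\<close>
  an iterated integral is measurable in its parameters; this yields
  \<open>measurable_basic_fun\<close>.\<close>

lemma basic_fun_lborel:
  "basic_fun \<alpha> \<rho> \<phi> \<psi> \<eta> u v w = of_real (inverse (admissibility_const \<phi>))
     * (LINT b|lborel. LINT a|lborel. basic_integrand \<alpha> \<rho> \<phi> \<psi> \<eta> u v w a b)"
proof -
  have "(LINT a|lebesgue. basic_integrand \<alpha> \<rho> \<phi> \<psi> \<eta> u v w a b)
      = (LINT a|lborel. basic_integrand \<alpha> \<rho> \<phi> \<psi> \<eta> u v w a b)" for b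
    by (rule integral_completion) measurable
  then show ?thesis
    by (simp add: basic_fun_def) (intro disjI2 integral_completion; measurable)
qed

lemma measurable_basic_fun [measurable (raw)]:
  assumes [measurable]: "u \<in> borel_measurable M" "v \<in> borel_measurable M" "w \<in> borel_measurable M"
  shows "(\<lambda>x. basic_fun \<alpha> \<rho> \<phi> \<psi> \<eta> (u x) (v x) (w x)) \<in> borel_measurable M"
  unfolding basic_fun_lborel by measurable

lemma norm_basic_fun_le:
  assumes "0 < admissibility_const \<phi>"
  shows "ennreal (norm (basic_fun \<alpha> \<rho> \<phi> \<psi> \<eta> u v w))
    \<le> ennreal (inverse (admissibility_const \<phi>)) * abs_basic \<alpha> \<rho> \<phi> \<psi> \<eta> u v w"
proof -
  have "ennreal (norm (LINT b|lborel. LINT a|lborel. basic_integrand \<alpha> \<rho> \<phi> \<psi> \<eta> u v w a b))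
     \<le> (\<integral>\<^sup>+b. ennreal (norm (LINT a|lborel. basic_integrand \<alpha> \<rho> \<phi> \<psi> \<eta> u v w a b)) \<partial>lborel)"
    by (rule ennreal_norm_integral_le)
  also have "\<dots> \<le> abs_basic \<alpha> \<rho> \<phi> \<psi> \<eta> u v w"
    unfolding abs_basic_def by (intro nn_integral_mono ennreal_norm_integral_le)
  finally show ?thesis
    using assms by (simp add: basic_fun_lborel norm_mult norm_inverse ennreal_mult' mult_left_mono)
qed

text \<open>\<open>lebesgue\<close> on the plane is the completion of the product of two copies of
  \<open>lborel\<close>, so Tonelli is applied on the product and integrability is then carried to
  the completion.\<close>

lemma integrable_basic_integrand:
  assumes "abs_basic \<alpha> \<rho> \<phi> \<psi> \<eta> u v w < \<infinity>"
  shows "integrable lebesgue (\<lambda>(a, b). basic_integrand \<alpha> \<rho> \<phi> \<psi> \<eta> u v w a b)"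
proof -
  have [measurable]: "(\<lambda>(a, b). basic_integrand \<alpha> \<rho> \<phi> \<psi> \<eta> u v w a b)
      \<in> borel_measurable (lborel \<Otimes>\<^sub>M lborel)" by measurable
  have "(\<integral>\<^sup>+x. ennreal (norm (case x of (a, b) \<Rightarrow> basic_integrand \<alpha> \<rho> \<phi> \<psi> \<eta> u v w a b)) \<partial>(lborel \<Otimes>\<^sub>M lborel))
      = abs_basic \<alpha> \<rho> \<phi> \<psi> \<eta> u v w"
    unfolding abs_basic_def by (subst lborel_pair.nn_integral_snd[symmetric]) auto
  then have "integrable (lborel \<Otimes>\<^sub>M lborel) (\<lambda>(a, b). basic_integrand \<alpha> \<rho> \<phi> \<psi> \<eta> u v w a b)"
    using assms by (intro integrableI_bounded) auto
  then show ?thesis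
    unfolding lborel_prod using borel_measurable_integrable integrable_completion by blast
qed

lemma nn_integral_abs_basic:
  assumes vw: "v \<noteq> w"
  shows "(\<integral>\<^sup>+u. abs_basic \<alpha> \<rho> \<phi> \<psi> \<eta> u v w \<partial>lborel)
    = (\<integral>\<^sup>+x. ennreal (norm (\<phi> x)) \<partial>lborel)
      * (\<integral>\<^sup>+x. \<integral>\<^sup>+y. ennreal (norm (\<psi> x) * norm (\<eta> y) * \<bar>x - y\<bar> powr (- (1 - \<rho>))) \<partial>lborel \<partial>lborel)
      * ennreal (\<bar>w - v\<bar> powr (- \<rho>))"
proof -
  let ?N = "\<lambda>u a b. ennreal (norm (basic_integrand \<alpha> \<rho> \<phi> \<psi> \<eta> u v w a b))"
  let ?k = "\<lambda>a b. ennreal (\<bar>a\<bar> powr (- \<rho> - 2) * norm (\<psi> ((w - b) / a)) * norm (\<eta> ((v - b) / a)))"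
  let ?P = "\<integral>\<^sup>+x. ennreal (norm (\<phi> x)) \<partial>lborel"
  \<comment> \<open>Only the factor with \<phi> contains u. The Jacobian of u = b + a t raises the
    exponent of \<bar>a\<bar> from - \<rho> - 3 to the - \<rho> - 2 of
    \<open>nn_integral_wavelet_kernel\<close>; at a = 0 both sides are 0.\<close>
  have inner_u: "(\<integral>\<^sup>+u. ?N u a b \<partial>lborel) = ?P * ?k a b" for a b
  proof (cases "a = 0")
    case False
    have pw: "\<bar>a\<bar> * \<bar>a\<bar> powr (- \<rho> - 3) = \<bar>a\<bar> powr (- \<rho> - 2)"
    proof -
      have "\<bar>a\<bar> * \<bar>a\<bar> powr (- \<rho> - 3) = \<bar>a\<bar> powr 1 * \<bar>a\<bar> powr (- \<rho> - 3)"
        using False by simp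
      also have "\<dots> = \<bar>a\<bar> powr (1 + (- \<rho> - 3))" by (rule powr_add[symmetric])
      also have "1 + (- \<rho> - 3) = - \<rho> - 2" by simp
      finally show ?thesis .
    qed
    have "(\<integral>\<^sup>+u. ?N u a b \<partial>lborel) = ennreal \<bar>a\<bar> * (\<integral>\<^sup>+t. ?N (b + a * t) a b \<partial>lborel)"
      using False by (intro nn_integral_real_affine) measurable
    also have "\<dots> = (\<integral>\<^sup>+t. ennreal \<bar>a\<bar> * ?N (b + a * t) a b \<partial>lborel)"
      by (rule nn_integral_cmult[symmetric]) measurable
    also have "\<dots> = (\<integral>\<^sup>+t. ?k a b * ennreal (norm (\<phi> t)) \<partial>lborel)"
      using False by (intro nn_integral_cong)
        (simp add: norm_basic_integrand mult.assoc flip: ennreal_mult' pw)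
    also have "\<dots> = ?k a b * ?P" by (rule nn_integral_cmult) measurable
    finally show ?thesis by (simp only: mult.commute)
  qed (simp add: norm_basic_integrand)
  have "(\<integral>\<^sup>+u. abs_basic \<alpha> \<rho> \<phi> \<psi> \<eta> u v w \<partial>lborel) = (\<integral>\<^sup>+u. \<integral>\<^sup>+b. \<integral>\<^sup>+a. ?N u a b \<partial>lborel \<partial>lborel \<partial>lborel)"
    by (simp add: abs_basic_def)
  also have "\<dots> = (\<integral>\<^sup>+b. \<integral>\<^sup>+u. \<integral>\<^sup>+a. ?N u a b \<partial>lborel \<partial>lborel \<partial>lborel)"
    by (rule lborel_pair.Fubini') measurable
  also have "\<dots> = (\<integral>\<^sup>+b. \<integral>\<^sup>+a. \<integral>\<^sup>+u. ?N u a b \<partial>lborel \<partial>lborel \<partial>lborel)"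
    by (intro nn_integral_cong lborel_pair.Fubini') measurable
  also have "\<dots> = (\<integral>\<^sup>+b. \<integral>\<^sup>+a. ?P * ?k a b \<partial>lborel \<partial>lborel)"
    by (simp only: inner_u)
  also have "\<dots> = ?P * (\<integral>\<^sup>+b. \<integral>\<^sup>+a. ?k a b \<partial>lborel \<partial>lborel)"
    by (simp add: nn_integral_cmult)
  also have "(\<integral>\<^sup>+b. \<integral>\<^sup>+a. ?k a b \<partial>lborel \<partial>lborel) = ennreal (\<bar>w - v\<bar> powr (- \<rho>))
      * (\<integral>\<^sup>+x. \<integral>\<^sup>+y. ennreal (norm (\<psi> x) * norm (\<eta> y) * \<bar>x - y\<bar> powr (- (1 - \<rho>))) \<partial>lborel \<partial>lborel)"
    by (rule nn_integral_wavelet_kernel) (use vw in auto)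
  finally show ?thesis by (simp add: mult_ac)
qed

definition abs_wconv :: "(real \<Rightarrow> complex) \<Rightarrow> (real \<Rightarrow> complex) \<Rightarrow> real \<Rightarrow> ennreal" where
  "abs_wconv h g u = (\<integral>\<^sup>+w. \<integral>\<^sup>+v. abs_basic \<alpha> \<rho> \<phi> \<psi> \<eta> u v w * ennreal (norm (h w) * norm (g v)) \<partial>lborel \<partial>lborel)"

section \<open>Absolute bounds for the convolution\<close>

context
  fixes h g :: "real \<Rightarrow> complex"
  assumes borel_hg [measurable]: "h \<in> borel_measurable borel" "g \<in> borel_measurable borel"
begin

lemma nn_integral_abs_wconv:
  "(\<integral>\<^sup>+u. abs_wconv h g u \<partial>lborel)
    = (\<integral>\<^sup>+x. ennreal (norm (\<phi> x)) \<partial>lborel)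
      * (\<integral>\<^sup>+x. \<integral>\<^sup>+y. ennreal (norm (\<psi> x) * norm (\<eta> y) * \<bar>x - y\<bar> powr (- (1 - \<rho>))) \<partial>lborel \<partial>lborel)
      * (\<integral>\<^sup>+w. \<integral>\<^sup>+v. ennreal (norm (h w) * norm (g v) * \<bar>w - v\<bar> powr (- \<rho>)) \<partial>lborel \<partial>lborel)"
    (is "_ = ?P * ?J * _")
proof -
  let ?A = "\<lambda>u v w. abs_basic \<alpha> \<rho> \<phi> \<psi> \<eta> u v w * ennreal (norm (h w) * norm (g v))"
  have "(\<integral>\<^sup>+u. abs_wconv h g u \<partial>lborel) = (\<integral>\<^sup>+w. \<integral>\<^sup>+u. \<integral>\<^sup>+v. ?A u v w \<partial>lborel \<partial>lborel \<partial>lborel)"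
    unfolding abs_wconv_def by (rule lborel_pair.Fubini') measurable
  also have "\<dots> = (\<integral>\<^sup>+w. \<integral>\<^sup>+v. \<integral>\<^sup>+u. ?A u v w \<partial>lborel \<partial>lborel \<partial>lborel)"
    by (intro nn_integral_cong lborel_pair.Fubini') measurable
  also have "\<dots> = (\<integral>\<^sup>+w. \<integral>\<^sup>+v. ?P * ?J * ennreal (norm (h w) * norm (g v) * \<bar>w - v\<bar> powr (- \<rho>)) \<partial>lborel \<partial>lborel)"
  \<comment> \<open>\<open>nn_integral_abs_basic\<close> is available off the diagonal v = w only,
    hence the congruence almost everywhere in v for each w.\<close>
  proof (rule nn_integral_cong, rule nn_integral_cong_AE)
    fix w
    have "(\<integral>\<^sup>+u. ?A u v w \<partial>lborel) = ?P * ?J * ennreal (norm (h w) * norm (g v) * \<bar>w - v\<bar> powr (- \<rho>))"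
      if "v \<noteq> w" for v
    proof -
      have "(\<integral>\<^sup>+u. ?A u v w \<partial>lborel)
          = (\<integral>\<^sup>+u. abs_basic \<alpha> \<rho> \<phi> \<psi> \<eta> u v w \<partial>lborel) * ennreal (norm (h w) * norm (g v))"
        by (rule nn_integral_multc) measurable
      then show ?thesis
        by (simp add: nn_integral_abs_basic[OF that] mult.assoc flip: ennreal_mult')
          (simp add: mult_ac)
    qed
    then show "AE v in lborel. (\<integral>\<^sup>+u. ?A u v w \<partial>lborel)
        = ?P * ?J * ennreal (norm (h w) * norm (g v) * \<bar>w - v\<bar> powr (- \<rho>))"
      by (intro AE_I[of _ _ "{w}"]) auto
  qed
  also have "\<dots> = ?P * ?J * (\<integral>\<^sup>+w. \<integral>\<^sup>+v. ennreal (norm (h w) * norm (g v) * \<bar>w - v\<bar> powr (- \<rho>)) \<partial>lborel \<partial>lborel)"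
    by (simp add: nn_integral_cmult)
  finally show ?thesis .
qed

lemma wconv_lborel:
  "wconv \<alpha> \<rho> \<phi> \<psi> \<eta> h g u
    = (LINT w|lborel. LINT v|lborel. basic_fun \<alpha> \<rho> \<phi> \<psi> \<eta> u v w * h w * g v)"
proof -
  have "(LINT v|lebesgue. basic_fun \<alpha> \<rho> \<phi> \<psi> \<eta> u v w * h w * g v)
      = (LINT v|lborel. basic_fun \<alpha> \<rho> \<phi> \<psi> \<eta> u v w * h w * g v)" for w
    by (rule integral_completion) measurable
  then show ?thesis
    unfolding wconv_def by (simp only:) (rule integral_completion; measurable)
qed

lemma measurable_wconv: "wconv \<alpha> \<rho> \<phi> \<psi> \<eta> h g \<in> borel_measurable borel"
  unfolding wconv_lborel[abs_def] by measurable

lemma measurable_abs_wconv [measurable]: "abs_wconv h g \<in> borel_measurable borel"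
  unfolding abs_wconv_def[abs_def] by measurable

context
  assumes adm: "0 < admissibility_const \<phi>"
begin

lemma norm_wconv_integrand_le:
  "ennreal (norm (basic_fun \<alpha> \<rho> \<phi> \<psi> \<eta> u v w * h w * g v))
    \<le> ennreal (inverse (admissibility_const \<phi>))
      * (abs_basic \<alpha> \<rho> \<phi> \<psi> \<eta> u v w * ennreal (norm (h w) * norm (g v)))"
proof -
  have "ennreal (norm (basic_fun \<alpha> \<rho> \<phi> \<psi> \<eta> u v w * h w * g v))
      = ennreal (norm (basic_fun \<alpha> \<rho> \<phi> \<psi> \<eta> u v w)) * ennreal (norm (h w) * norm (g v))"
    by (simp add: norm_mult mult.assoc ennreal_mult')
  also have "\<dots> \<le> (ennreal (inverse (admissibility_const \<phi>)) * abs_basic \<alpha> \<rho> \<phi> \<psi> \<eta> u v w)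
      * ennreal (norm (h w) * norm (g v))"
    by (intro mult_right_mono norm_basic_fun_le adm) auto
  finally show ?thesis by (simp add: mult.assoc)
qed

lemma nn_integral_wconv_integrand_le:
  "(\<integral>\<^sup>+w. \<integral>\<^sup>+v. ennreal (norm (basic_fun \<alpha> \<rho> \<phi> \<psi> \<eta> u v w * h w * g v)) \<partial>lborel \<partial>lborel)
    \<le> ennreal (inverse (admissibility_const \<phi>)) * abs_wconv h g u"
proof -
  have "(\<integral>\<^sup>+w. \<integral>\<^sup>+v. ennreal (norm (basic_fun \<alpha> \<rho> \<phi> \<psi> \<eta> u v w * h w * g v)) \<partial>lborel \<partial>lborel)
     \<le> (\<integral>\<^sup>+w. \<integral>\<^sup>+v. ennreal (inverse (admissibility_const \<phi>))
      * (abs_basic \<alpha> \<rho> \<phi> \<psi> \<eta> u v w * ennreal (norm (h w) * norm (g v))) \<partial>lborel \<partial>lborel)"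
    by (intro nn_integral_mono norm_wconv_integrand_le)
  also have "\<dots> = ennreal (inverse (admissibility_const \<phi>)) * abs_wconv h g u"
    by (simp add: nn_integral_cmult abs_wconv_def)
  finally show ?thesis .
qed

lemma norm_wconv_le:
  "ennreal (norm (wconv \<alpha> \<rho> \<phi> \<psi> \<eta> h g u))
    \<le> ennreal (inverse (admissibility_const \<phi>)) * abs_wconv h g u"
proof -
  have "ennreal (norm (wconv \<alpha> \<rho> \<phi> \<psi> \<eta> h g u))
     \<le> (\<integral>\<^sup>+w. ennreal (norm (LINT v|lborel. basic_fun \<alpha> \<rho> \<phi> \<psi> \<eta> u v w * h w * g v)) \<partial>lborel)"
    unfolding wconv_lborel by (rule ennreal_norm_integral_le)
  also have "\<dots> \<le> (\<integral>\<^sup>+w. \<integral>\<^sup>+v. ennreal (norm (basic_fun \<alpha> \<rho> \<phi> \<psi> \<eta> u v w * h w * g v)) \<partial>lborel \<partial>lborel)"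
    by (intro nn_integral_mono ennreal_norm_integral_le)
  also note nn_integral_wconv_integrand_le
  finally show ?thesis .
qed

lemma integrable_wconv_integrand:
  assumes "abs_wconv h g u < \<infinity>"
  shows "integrable lebesgue (\<lambda>(v, w). basic_fun \<alpha> \<rho> \<phi> \<psi> \<eta> u v w * h w * g v)"
proof -
  have [measurable]: "(\<lambda>(v, w). basic_fun \<alpha> \<rho> \<phi> \<psi> \<eta> u v w * h w * g v)
      \<in> borel_measurable (lborel \<Otimes>\<^sub>M lborel)" by measurable
  have "(\<integral>\<^sup>+x. ennreal (norm (case x of (v, w) \<Rightarrow> basic_fun \<alpha> \<rho> \<phi> \<psi> \<eta> u v w * h w * g v)) \<partial>(lborel \<Otimes>\<^sub>M lborel))
      = (\<integral>\<^sup>+w. \<integral>\<^sup>+v. ennreal (norm (basic_fun \<alpha> \<rho> \<phi> \<psi> \<eta> u v w * h w * g v)) \<partial>lborel \<partial>lborel)"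
    by (subst lborel_pair.nn_integral_snd[symmetric]) auto
  also note nn_integral_wconv_integrand_le
  also have "ennreal (inverse (admissibility_const \<phi>)) * abs_wconv h g u < \<infinity>"
    using assms by (simp add: ennreal_mult_less_top)
  finally have "integrable (lborel \<Otimes>\<^sub>M lborel) (\<lambda>(v, w). basic_fun \<alpha> \<rho> \<phi> \<psi> \<eta> u v w * h w * g v)"
    by (intro integrableI_bounded) auto
  then show ?thesis
    unfolding lborel_prod using borel_measurable_integrable integrable_completion by blast
qed

lemma AE_wconv_converges:
  assumes fin: "(\<integral>\<^sup>+u. abs_wconv h g u \<partial>lborel) < \<infinity>"
    "(\<integral>\<^sup>+x. ennreal (norm (\<phi> x)) \<partial>lborel) < \<infinity>"
    "(\<integral>\<^sup>+x. \<integral>\<^sup>+y. ennreal (norm (\<psi> x) * norm (\<eta> y) * \<bar>x - y\<bar> powr (- (1 - \<rho>))) \<partial>lborel \<partial>lborel) < \<infinity>"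
  shows "AE u in lebesgue. wconv_converges \<alpha> \<rho> \<phi> \<psi> \<eta> h g u"
proof -
  \<comment> \<open>The diagonal is null in the plane, which makes
    \<open>nn_integral_abs_basic\<close> usable at almost every (v, w).\<close>
  have ne: "AE x in (lborel :: (real \<times> real) measure). fst x \<noteq> snd x"
  proof -
    have "{x \<in> space (lborel \<Otimes>\<^sub>M lborel). fst x \<noteq> (snd x :: real)} \<in> sets (lborel \<Otimes>\<^sub>M lborel)"
      by measurable
    moreover have "AE w in lborel. v \<noteq> w" for v :: real
      by (intro AE_I[of _ _ "{v}"]) auto
    ultimately have "AE x in lborel \<Otimes>\<^sub>M lborel. fst x \<noteq> (snd x :: real)"
      by (intro lborel_pair.AE_pair_measure) simp_all
    then show ?thesis by (simp only: lborel_prod)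
  qed
  \<comment> \<open>Finiteness of \<^const>\<open>abs_wconv\<close> says nothing where \<open>h\<close> or \<open>g\<close> vanishes, so convergence of the
    basic function is obtained from its own \<open>u\<close>-integral.\<close>
  have "AE x in lborel. AE u in lborel. abs_basic \<alpha> \<rho> \<phi> \<psi> \<eta> u (fst x) (snd x) \<noteq> \<infinity>"
    using ne
  proof eventually_elim
    case (elim x)
    show ?case
      by (intro nn_integral_PInf_AE)
        (use fin in \<open>auto simp: nn_integral_abs_basic[OF elim] ennreal_mult_eq_top_iff less_top\<close>)
  qed
  moreover have "{x \<in> space ((lborel :: (real \<times> real) measure) \<Otimes>\<^sub>M lborel).
      abs_basic \<alpha> \<rho> \<phi> \<psi> \<eta> (snd x) (fst (fst x)) (snd (fst x)) \<noteq> \<infinity>} \<in> sets (lborel \<Otimes>\<^sub>M lborel)"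
  proof -
    have [measurable]: "fst \<in> borel_measurable (borel :: (real \<times> real) measure)"
      "snd \<in> borel_measurable (borel :: (real \<times> real) measure)"
      by (auto intro!: borel_measurable_continuous_onI continuous_intros)
    show ?thesis by measurable
  qed
  \<comment> \<open>Fubini for null sets, at the price of the joint measurability just shown:
    \<open>wconv_converges\<close> asks for a fixed u first and then almost every (v, w).\<close>
  ultimately have 1: "AE u in lborel. AE x in lborel. abs_basic \<alpha> \<rho> \<phi> \<psi> \<eta> u (fst x) (snd x) \<noteq> \<infinity>"
    by (subst (asm) lborel_pair.AE_commute) auto
  have 2: "AE u in lborel. abs_wconv h g u \<noteq> \<infinity>"
    by (rule nn_integral_PInf_AE) (use fin in auto)
  from 1 2 have "AE u in lborel. wconv_converges \<alpha> \<rho> \<phi> \<psi> \<eta> h g u"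
  proof eventually_elim
    case (elim u)
    from elim(1) have "AE x in lborel. case x of (v, w) \<Rightarrow>
        integrable lebesgue (\<lambda>(a, b). basic_integrand \<alpha> \<rho> \<phi> \<psi> \<eta> u v w a b)"
      by eventually_elim (auto simp: less_top intro!: integrable_basic_integrand)
    then show ?case
      unfolding wconv_converges_def using elim(2)
      by (auto simp: less_top intro!: integrable_wconv_integrand AE_completion)
  qed
  then show ?thesis by (rule AE_completion)
qed

end

end

end

section \<open>Passage to Borel representatives\<close>

lemma borel_representative:
  fixes f :: "real \<Rightarrow> complex"
  assumes "f \<in> borel_measurable lebesgue"
  obtains f' where "f' \<in> borel_measurable borel" "AE x in lborel. f x = f' x"
proof -
  have "(\<lambda>x. Re (f x)) \<in> borel_measurable lebesgue" "(\<lambda>x. Im (f x)) \<in> borel_measurable lebesgue"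
    using assms by (auto simp: borel_measurable_complex_iff)
  from this[THEN completion_ex_borel_measurable_real] obtain r i where
    [measurable]: "r \<in> borel_measurable lborel" "i \<in> borel_measurable lborel"
    and ae: "AE x in lborel. Re (f x) = r x" "AE x in lborel. Im (f x) = i x" by blast
  show ?thesis
  proof
    show "(\<lambda>x. Complex (r x) (i x)) \<in> borel_measurable borel"
      by (auto simp: borel_measurable_complex_iff)
    from ae show "AE x in lborel. f x = Complex (r x) (i x)"
      by eventually_elim (auto intro: complex_eqI)
  qed
qed

text \<open>Completeness of the measure transfers measurability from f to g, so below only the Borel
  version of an integrand needs a measurability argument.\<close>

lemma integral_lebesgue_cong_AE:
  fixes f g :: "'a::euclidean_space \<Rightarrow> 'b::euclidean_space"
  assumes "f \<in> borel_measurable lebesgue" "AE x in lborel. f x = g x"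
  shows "integral\<^sup>L lebesgue f = integral\<^sup>L lebesgue g"
    and "integrable lebesgue f \<longleftrightarrow> integrable lebesgue g"
    and "g \<in> borel_measurable lebesgue"
proof -
  have ae: "AE x in lebesgue. f x = g x" using assms(2) by (rule AE_completion)
  show g: "g \<in> borel_measurable lebesgue" using borel_measurable_AE[OF assms(1) ae] .
  show "integral\<^sup>L lebesgue f = integral\<^sup>L lebesgue g" using integral_cong_AE[OF assms(1) g ae] .
  show "integrable lebesgue f \<longleftrightarrow> integrable lebesgue g" using integrable_cong_AE[OF assms(1) g ae] .
qed

lemma AE_affine_notin:
  fixes N :: "real set"
  assumes "N \<in> null_sets lborel" "c \<noteq> 0"
  shows "AE x in lborel. t + c * x \<notin> N"
proof -
  have [measurable]: "N \<in> sets borel" using assms by auto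
  have "(\<integral>\<^sup>+x. indicator N x \<partial>lborel) = 0" using assms by auto
  then have "(\<integral>\<^sup>+x. indicator N (t + c * x) \<partial>lborel) = (0 :: ennreal)"
    using assms(2) by (subst (asm) nn_integral_real_affine[of _ c t]) auto
  then show ?thesis
    by (subst (asm) nn_integral_0_iff_AE) (auto simp: indicator_eq_0_iff)
qed

text \<open>Inversion turns the integral of the indicator of \<open>N\<close> at c / x into one at c
  x with weight 1 / x^2, which is the affine case.\<close>

lemma AE_divide_notin:
  fixes N :: "real set"
  assumes "N \<in> null_sets lborel" "c \<noteq> 0"
  shows "AE x in lborel. c / x \<notin> N"
proof -
  have [measurable]: "N \<in> sets borel" using assms by auto
  have "(\<integral>\<^sup>+x. ennreal (indicator N (c / x)) \<partial>lborel)
      = (\<integral>\<^sup>+x. ennreal (indicator N (c / (1 / x)) / x\<^sup>2) \<partial>lborel)"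
    by (rule nn_integral_inverse) measurable
  also have "\<dots> = (\<integral>\<^sup>+x. 0 \<partial>(lborel :: real measure))"
    using AE_affine_notin[OF assms, of 0] by (intro nn_integral_cong_AE) auto
  finally show ?thesis
    by (simp add: nn_integral_0_iff_AE) (auto simp: indicator_eq_0_iff)
qed

section \<open>Independence of the chosen representatives\<close>

context
  fixes \<phi> \<psi> \<eta> \<phi>' \<psi>' \<eta>' :: "real \<Rightarrow> complex"
  assumes borel': "\<phi>' \<in> borel_measurable borel" "\<psi>' \<in> borel_measurable borel"
      "\<eta>' \<in> borel_measurable borel"
    and ae: "AE x in lborel. \<phi> x = \<phi>' x" "AE x in lborel. \<psi> x = \<psi>' x" "AE x in lborel. \<eta> x = \<eta>' x"
begin

text \<open>A single null set serves all three functions and all parameters. What remains each time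
  is that its preimages under (t - b) / a are null in the variables of integration.\<close>

lemma basic_integrand_exceptional_set:
  obtains N where "N \<in> null_sets lborel"
    "\<And>\<alpha> \<rho> u v w a b. (u - b) / a \<notin> N \<Longrightarrow> (v - b) / a \<notin> N \<Longrightarrow> (w - b) / a \<notin> N \<Longrightarrow>
      basic_integrand \<alpha> \<rho> \<phi>' \<psi>' \<eta>' u v w a b = basic_integrand \<alpha> \<rho> \<phi> \<psi> \<eta> u v w a b"
proof -
  have "AE x in lborel. \<phi> x = \<phi>' x \<and> \<psi> x = \<psi>' x \<and> \<eta> x = \<eta>' x"
    using ae by eventually_elim auto
  from AE_E3[OF this] obtain N where N: "N \<in> null_sets lborel"
    "\<And>x. x \<notin> N \<Longrightarrow> \<phi> x = \<phi>' x \<and> \<psi> x = \<psi>' x \<and> \<eta> x = \<eta>' x"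
    by auto
  show ?thesis
  proof (rule that[OF N(1)])
    fix \<alpha> \<rho> u v w a b
    assume "(u - b) / a \<notin> N" "(v - b) / a \<notin> N" "(w - b) / a \<notin> N"
    then have "\<phi> ((u - b) / a) = \<phi>' ((u - b) / a)" "\<eta> ((v - b) / a) = \<eta>' ((v - b) / a)"
      "\<psi> ((w - b) / a) = \<psi>' ((w - b) / a)"
      using N(2) by auto
    then show "basic_integrand \<alpha> \<rho> \<phi>' \<psi>' \<eta>' u v w a b = basic_integrand \<alpha> \<rho> \<phi> \<psi> \<eta> u v w a b"
      by (simp add: basic_integrand_def atom_def)
  qed
qed

lemma admissibility_const_cong: "admissibility_const \<phi>' = admissibility_const \<phi>"
proof -
  have f: "fourier \<phi>' = fourier \<phi>"
  proof
    fix \<omega>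
    have "(\<lambda>t. exp (- \<i> * of_real (\<omega> * t))) \<in> borel_measurable borel"
      by (intro borel_measurable_continuous_onI continuous_intros)
    then have 1: "(\<lambda>t. \<phi>' t * exp (- \<i> * of_real (\<omega> * t))) \<in> borel_measurable lebesgue"
      using borel' by (intro measurable_completion) simp
    have 2: "AE t in lborel. \<phi>' t * exp (- \<i> * of_real (\<omega> * t)) = \<phi> t * exp (- \<i> * of_real (\<omega> * t))"
      using ae(1) by eventually_elim simp
    show "fourier \<phi>' \<omega> = fourier \<phi> \<omega>"
      unfolding fourier_def by (rule integral_lebesgue_cong_AE(1)[OF 1 2])
  qed
  show ?thesis by (simp add: admissibility_const_def f)
qed

text \<open>Equality holds at every \<open>(u, v, w)\<close>, not only almost everywhere: for \<open>b \<notin> {u, v, w}\<close> the map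
  \<open>a \<mapsto> (u - b) / a\<close> pulls null sets back to null sets.\<close>

lemma basic_fun_cong:
  "basic_fun \<alpha> \<rho> \<phi>' \<psi>' \<eta>' u v w = basic_fun \<alpha> \<rho> \<phi> \<psi> \<eta> u v w"
proof -
  note [measurable] = borel'
  obtain N where N: "N \<in> null_sets lborel"
    "\<And>u v w a b. (u - b) / a \<notin> N \<Longrightarrow> (v - b) / a \<notin> N \<Longrightarrow> (w - b) / a \<notin> N \<Longrightarrow>
      basic_integrand \<alpha> \<rho> \<phi>' \<psi>' \<eta>' u v w a b = basic_integrand \<alpha> \<rho> \<phi> \<psi> \<eta> u v w a b"
    using basic_integrand_exceptional_set by metis
  have inner: "(LINT a|lebesgue. basic_integrand \<alpha> \<rho> \<phi>' \<psi>' \<eta>' u v w a b)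
      = (LINT a|lebesgue. basic_integrand \<alpha> \<rho> \<phi> \<psi> \<eta> u v w a b)"
    if "b \<noteq> u" "b \<noteq> v" "b \<noteq> w" for b
  proof (rule integral_lebesgue_cong_AE(1))
    show "(\<lambda>a. basic_integrand \<alpha> \<rho> \<phi>' \<psi>' \<eta>' u v w a b) \<in> borel_measurable lebesgue"
      by (intro measurable_completion) measurable
    have "AE a in lborel. (u - b) / a \<notin> N" "AE a in lborel. (v - b) / a \<notin> N"
      "AE a in lborel. (w - b) / a \<notin> N"
      using that by (auto intro!: AE_divide_notin N(1))
    then show "AE a in lborel. basic_integrand \<alpha> \<rho> \<phi>' \<psi>' \<eta>' u v w a b
        = basic_integrand \<alpha> \<rho> \<phi> \<psi> \<eta> u v w a b"
      by eventually_elim (rule N(2))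
  qed
  have "(LINT b|lebesgue. LINT a|lebesgue. basic_integrand \<alpha> \<rho> \<phi>' \<psi>' \<eta>' u v w a b)
      = (LINT b|lebesgue. LINT a|lebesgue. basic_integrand \<alpha> \<rho> \<phi> \<psi> \<eta> u v w a b)"
  proof (rule integral_lebesgue_cong_AE(1))
    have "(LINT a|lebesgue. basic_integrand \<alpha> \<rho> \<phi>' \<psi>' \<eta>' u v w a b)
        = (LINT a|lborel. basic_integrand \<alpha> \<rho> \<phi>' \<psi>' \<eta>' u v w a b)" for b
      by (rule integral_completion) measurable
    then show "(\<lambda>b. LINT a|lebesgue. basic_integrand \<alpha> \<rho> \<phi>' \<psi>' \<eta>' u v w a b) \<in> borel_measurable lebesgue"
      by (simp only:) (intro measurable_completion; measurable)
    show "AE b in lborel. (LINT a|lebesgue. basic_integrand \<alpha> \<rho> \<phi>' \<psi>' \<eta>' u v w a b)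
      = (LINT a|lebesgue. basic_integrand \<alpha> \<rho> \<phi> \<psi> \<eta> u v w a b)"
      by (rule AE_I'[OF finite_imp_null_set_lborel[of "{u, v, w}"]]) (auto intro: inner ccontr)
  qed
  then show ?thesis by (simp add: basic_fun_def admissibility_const_cong)
qed

text \<open>For a \<noteq> 0 the map b -> (t - b) / a is affine and nonconstant, so almost every
  section of the exceptional set in the (a, b) plane is null, and hence so is the set.\<close>

lemma integrable_basic_integrand_cong:
  "integrable lebesgue (\<lambda>(a, b). basic_integrand \<alpha> \<rho> \<phi>' \<psi>' \<eta>' u v w a b)
    \<longleftrightarrow> integrable lebesgue (\<lambda>(a, b). basic_integrand \<alpha> \<rho> \<phi> \<psi> \<eta> u v w a b)"
proof (rule integral_lebesgue_cong_AE(2))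
  note [measurable] = borel'
  have "(\<lambda>(a, b). basic_integrand \<alpha> \<rho> \<phi>' \<psi>' \<eta>' u v w a b) \<in> borel_measurable (lborel \<Otimes>\<^sub>M lborel)"
    by measurable
  then show "(\<lambda>(a, b). basic_integrand \<alpha> \<rho> \<phi>' \<psi>' \<eta>' u v w a b) \<in> borel_measurable lebesgue"
    unfolding lborel_prod by (rule measurable_completion)
  obtain N where N: "N \<in> null_sets lborel"
    "\<And>u v w a b. (u - b) / a \<notin> N \<Longrightarrow> (v - b) / a \<notin> N \<Longrightarrow> (w - b) / a \<notin> N \<Longrightarrow>
      basic_integrand \<alpha> \<rho> \<phi>' \<psi>' \<eta>' u v w a b = basic_integrand \<alpha> \<rho> \<phi> \<psi> \<eta> u v w a b"
    using basic_integrand_exceptional_set by metis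
  have [measurable]: "N \<in> sets borel" using N(1) by auto
  have null: "AE x in lborel. (t - snd x) / fst x \<notin> N" for t
  proof -
    have "AE b in lborel. (t - b) / a \<notin> N" if "a \<noteq> 0" for a
    proof -
      have "AE b in lborel. t / a + (- (1 / a)) * b \<notin> N"
        using that by (intro AE_affine_notin N(1)) auto
      then show ?thesis by (simp add: diff_divide_distrib)
    qed
    then have "AE a in lborel. AE b in lborel. (t - b) / a \<notin> N"
      by (intro AE_I[of _ _ "{0}"]) auto
    moreover have "{x \<in> space (lborel \<Otimes>\<^sub>M lborel). (t - snd x) / fst x \<notin> N} \<in> sets (lborel \<Otimes>\<^sub>M lborel)"
      by measurable
    ultimately have "AE x in lborel \<Otimes>\<^sub>M lborel. (t - snd x) / fst x \<notin> N"
      by (intro lborel_pair.AE_pair_measure) auto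
    then show ?thesis by (simp only: lborel_prod)
  qed
  from null[of u] null[of v] null[of w]
  show "AE x in lborel. (case x of (a, b) \<Rightarrow> basic_integrand \<alpha> \<rho> \<phi>' \<psi>' \<eta>' u v w a b)
      = (case x of (a, b) \<Rightarrow> basic_integrand \<alpha> \<rho> \<phi> \<psi> \<eta> u v w a b)"
    by eventually_elim (auto intro: N(2))
qed

context
  fixes h g h' g' :: "real \<Rightarrow> complex"
  assumes borel_hg': "h' \<in> borel_measurable borel" "g' \<in> borel_measurable borel"
    and ae_hg: "AE x in lborel. h x = h' x" "AE x in lborel. g x = g' x"
begin

text \<open>g is exchanged under the inner integral and h under the outer one. The basic function
  needs no almost-everywhere argument here, since \<open>basic_fun_cong\<close> is an identity at
  every point.\<close>

lemma wconv_cong: "wconv \<alpha> \<rho> \<phi>' \<psi>' \<eta>' h' g' = wconv \<alpha> \<rho> \<phi> \<psi> \<eta> h g"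
proof
  note [measurable] = borel' borel_hg'
  fix u
  let ?B = "\<lambda>v w. basic_fun \<alpha> \<rho> \<phi>' \<psi>' \<eta>' u v w"
  have inner: "(LINT v|lebesgue. ?B v w * h' w * g' v) = (LINT v|lebesgue. ?B v w * h' w * g v)" for w
  proof (rule integral_lebesgue_cong_AE(1))
    show "(\<lambda>v. ?B v w * h' w * g' v) \<in> borel_measurable lebesgue"
      by (intro measurable_completion) measurable
    show "AE v in lborel. ?B v w * h' w * g' v = ?B v w * h' w * g v"
      using ae_hg(2) by eventually_elim simp
  qed
  have "wconv \<alpha> \<rho> \<phi>' \<psi>' \<eta>' h' g' u = (LINT w|lebesgue. LINT v|lebesgue. ?B v w * h w * g v)"
    unfolding wconv_def
  proof (rule integral_lebesgue_cong_AE(1))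
    have "(LINT v|lebesgue. ?B v w * h' w * g' v) = (LINT v|lborel. ?B v w * h' w * g' v)" for w
      by (rule integral_completion) measurable
    then show "(\<lambda>w. LINT v|lebesgue. ?B v w * h' w * g' v) \<in> borel_measurable lebesgue"
      by (simp only:) (intro measurable_completion; measurable)
    show "AE w in lborel. (LINT v|lebesgue. ?B v w * h' w * g' v) = (LINT v|lebesgue. ?B v w * h w * g v)"
      using ae_hg(1) by eventually_elim (simp only: inner)
  qed
  then show "wconv \<alpha> \<rho> \<phi>' \<psi>' \<eta>' h' g' u = wconv \<alpha> \<rho> \<phi> \<psi> \<eta> h g u"
    by (simp add: wconv_def basic_fun_cong)
qed

lemma wconv_converges_cong:
  "wconv_converges \<alpha> \<rho> \<phi>' \<psi>' \<eta>' h' g' u \<longleftrightarrow> wconv_converges \<alpha> \<rho> \<phi> \<psi> \<eta> h g u"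
proof -
  note [measurable] = borel' borel_hg'
  have "integrable lebesgue (\<lambda>(v, w). basic_fun \<alpha> \<rho> \<phi>' \<psi>' \<eta>' u v w * h' w * g' v)
    \<longleftrightarrow> integrable lebesgue (\<lambda>(v, w). basic_fun \<alpha> \<rho> \<phi> \<psi> \<eta> u v w * h w * g v)"
  proof (rule integral_lebesgue_cong_AE(2))
    have "(\<lambda>(v, w). basic_fun \<alpha> \<rho> \<phi>' \<psi>' \<eta>' u v w * h' w * g' v) \<in> borel_measurable (lborel \<Otimes>\<^sub>M lborel)"
      by measurable
    then show "(\<lambda>(v, w). basic_fun \<alpha> \<rho> \<phi>' \<psi>' \<eta>' u v w * h' w * g' v) \<in> borel_measurable lebesgue"
      unfolding lborel_prod by (rule measurable_completion)
    obtain N where N: "N \<in> null_sets lborel" "\<And>x. x \<notin> N \<Longrightarrow> h x = h' x \<and> g x = g' x"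
    proof -
      have "AE x in lborel. h x = h' x \<and> g x = g' x"
        using ae_hg by eventually_elim auto
      from AE_E3[OF this] show ?thesis using that by auto
    qed
    have [measurable]: "N \<in> sets borel" using N(1) by auto
    have notin: "AE x in lborel. x \<notin> N" using N(1) by (rule AE_not_in)
    from notin have "AE v in lborel. AE w in lborel. v \<notin> N \<and> w \<notin> N"
      by (rule eventually_mono) (use notin in simp)
    moreover have "{x \<in> space (lborel \<Otimes>\<^sub>M lborel). fst x \<notin> N \<and> snd x \<notin> N} \<in> sets (lborel \<Otimes>\<^sub>M lborel)"
      by measurable
    ultimately have "AE x in lborel \<Otimes>\<^sub>M lborel. fst x \<notin> N \<and> snd x \<notin> N"
      by (intro lborel_pair.AE_pair_measure) auto
    then have "AE x in lborel. fst x \<notin> N \<and> snd x \<notin> N" by (simp only: lborel_prod)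
    then show "AE x in lborel. (case x of (v, w) \<Rightarrow> basic_fun \<alpha> \<rho> \<phi>' \<psi>' \<eta>' u v w * h' w * g' v)
        = (case x of (v, w) \<Rightarrow> basic_fun \<alpha> \<rho> \<phi> \<psi> \<eta> u v w * h w * g v)"
      by eventually_elim (auto simp: N(2) basic_fun_cong)
  qed
  then show ?thesis
    by (simp add: wconv_converges_def integrable_basic_integrand_cong)
qed

end

end

section \<open>The bound for the convolution\<close>

lemma Lp_cong_AE:
  assumes "f' \<in> borel_measurable borel" "AE x in lborel. f x = f' x"
  shows "Lp_norm p f' = Lp_norm p f" and "f \<in> Lp_space p \<Longrightarrow> f' \<in> Lp_space p"
proof -
  have [measurable]: "f' \<in> borel_measurable lebesgue"
    using assms(1) by (intro measurable_completion) simp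
  have 1: "(\<lambda>x. norm (f' x) powr p) \<in> borel_measurable lebesgue" by measurable
  have 2: "AE x in lborel. norm (f' x) powr p = norm (f x) powr p"
    using assms(2) by eventually_elim simp
  show "Lp_norm p f' = Lp_norm p f"
    by (simp add: Lp_norm_def integral_lebesgue_cong_AE(1)[OF 1 2])
  show "f \<in> Lp_space p \<Longrightarrow> f' \<in> Lp_space p"
    using integral_lebesgue_cong_AE(2)[OF 1 2] by (simp add: Lp_space_def)
qed

lemma Lp_space_lborel:
  assumes "f \<in> borel_measurable borel"
  shows "f \<in> Lp_space p \<longleftrightarrow> integrable lborel (\<lambda>x. norm (f x) powr p)"
    and "Lp_norm p f = (LINT x|lborel. norm (f x) powr p) powr (1 / p)"
proof -
  note [measurable] = assms
  have "(\<lambda>x. norm (f x) powr p) \<in> borel_measurable lborel" by measurable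
  moreover have "f \<in> borel_measurable lebesgue"
    by (intro measurable_completion) measurable
  ultimately show "f \<in> Lp_space p \<longleftrightarrow> integrable lborel (\<lambda>x. norm (f x) powr p)"
    and "Lp_norm p f = (LINT x|lborel. norm (f x) powr p) powr (1 / p)"
    by (simp_all add: Lp_space_def Lp_norm_def integrable_completion integral_completion)
qed

lemma wconv_bound_borel:
  fixes \<phi> \<psi> \<eta> h g :: "real \<Rightarrow> complex"
  assumes borel [measurable]: "\<phi> \<in> borel_measurable borel" "\<psi> \<in> borel_measurable borel"
      "\<eta> \<in> borel_measurable borel" "h \<in> borel_measurable borel" "g \<in> borel_measurable borel"
    and pq: "1 < p" "1 < q" "0 < \<rho>" "\<rho> < 1" "1 / p + 1 / q = \<rho> + 1"
    and rr: "1 < r" "1 < r'" "1 / r + 1 / r' + \<rho> = 2"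
    and Lp: "\<phi> \<in> Lp_space 1" "\<psi> \<in> Lp_space p" "\<eta> \<in> Lp_space q" "h \<in> Lp_space r" "g \<in> Lp_space r'"
    and adm: "0 < admissibility_const \<phi>"
  shows "AE u in lebesgue. wconv_converges \<alpha> \<rho> \<phi> \<psi> \<eta> h g u"
    and "wconv \<alpha> \<rho> \<phi> \<psi> \<eta> h g \<in> Lp_space 1"
    and "Lp_norm 1 (wconv \<alpha> \<rho> \<phi> \<psi> \<eta> h g)
      \<le> inverse (admissibility_const \<phi>) * (hls_const (1 - \<rho>) p q * hls_const \<rho> r r')
        * Lp_norm 1 \<phi> * Lp_norm p \<psi> * Lp_norm q \<eta> * Lp_norm r' g * Lp_norm r h"
proof -
  let ?c = "inverse (admissibility_const \<phi>)"
  let ?A1 = "hls_const (1 - \<rho>) p q * Lp_norm p \<psi> * Lp_norm q \<eta>"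
  let ?A2 = "hls_const \<rho> r r' * Lp_norm r h * Lp_norm r' g"
  \<comment> \<open>\<open>ennreal\<close> sends negative reals to 0; nonnegativity lets the bounds
    be multiplied there and read back as a real inequality.\<close>
  have hls: "0 \<le> hls_const (1 - \<rho>) p q" "0 \<le> hls_const \<rho> r r'"
    using pq rr by (auto intro!: hls_const_nonneg)
  have Lpn: "0 \<le> Lp_norm s f" for s f by (simp add: Lp_norm_def)
  have "(\<integral>\<^sup>+x. ennreal (norm (\<phi> x)) \<partial>lborel) = ennreal (LINT x|lborel. norm (\<phi> x))"
    using Lp(1) by (intro nn_integral_eq_integral) (auto simp: Lp_space_lborel)
  then have P: "(\<integral>\<^sup>+x. ennreal (norm (\<phi> x)) \<partial>lborel) = ennreal (Lp_norm 1 \<phi>)"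
    by (simp add: Lp_space_lborel)
  \<comment> \<open>With \<kappa> = 1 - \<rho>, the relation 1/p + 1/q = \<rho> + 1 becomes 1/p +
    1/q + \<kappa> = 2.\<close>
  have J: "(\<integral>\<^sup>+x. \<integral>\<^sup>+y. ennreal (norm (\<psi> x) * norm (\<eta> y) * \<bar>x - y\<bar> powr (- (1 - \<rho>))) \<partial>lborel \<partial>lborel)
      \<le> ennreal ?A1" (is "?J \<le> _")
    unfolding Lp_space_lborel(2)[OF borel(2)] Lp_space_lborel(2)[OF borel(3)]
    by (rule hardy_littlewood_sobolev) (use pq Lp in \<open>auto simp: Lp_space_lborel\<close>)
  have H: "(\<integral>\<^sup>+w. \<integral>\<^sup>+v. ennreal (norm (h w) * norm (g v) * \<bar>w - v\<bar> powr (- \<rho>)) \<partial>lborel \<partial>lborel)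
      \<le> ennreal ?A2" (is "?H \<le> _")
    unfolding Lp_space_lborel(2)[OF borel(4)] Lp_space_lborel(2)[OF borel(5)]
    by (rule hardy_littlewood_sobolev) (use pq rr Lp in \<open>auto simp: Lp_space_lborel\<close>)
  have "(\<integral>\<^sup>+u. abs_wconv \<alpha> \<rho> \<phi> \<psi> \<eta> h g u \<partial>lborel) = ennreal (Lp_norm 1 \<phi>) * ?J * ?H"
    by (simp add: nn_integral_abs_wconv P)
  also have "\<dots> \<le> ennreal (Lp_norm 1 \<phi>) * ennreal ?A1 * ennreal ?A2"
    by (intro mult_mono J H) auto
  also have "\<dots> = ennreal (Lp_norm 1 \<phi> * ?A1 * ?A2)"
    using hls Lpn by (simp add: ennreal_mult')
  finally have T: "(\<integral>\<^sup>+u. abs_wconv \<alpha> \<rho> \<phi> \<psi> \<eta> h g u \<partial>lborel) \<le> ennreal (Lp_norm 1 \<phi> * ?A1 * ?A2)" .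
  show "AE u in lebesgue. wconv_converges \<alpha> \<rho> \<phi> \<psi> \<eta> h g u"
  proof (rule AE_wconv_converges[OF borel adm])
    show "(\<integral>\<^sup>+u. abs_wconv \<alpha> \<rho> \<phi> \<psi> \<eta> h g u \<partial>lborel) < \<infinity>"
      using T by (rule order.strict_trans1) simp
    show "(\<integral>\<^sup>+x. ennreal (norm (\<phi> x)) \<partial>lborel) < \<infinity>" by (simp add: P)
    show "?J < \<infinity>" using J by (rule order.strict_trans1) simp
  qed
  have wm [measurable]: "wconv \<alpha> \<rho> \<phi> \<psi> \<eta> h g \<in> borel_measurable borel"
    by (rule measurable_wconv[OF borel])
  have "(\<integral>\<^sup>+u. ennreal (norm (wconv \<alpha> \<rho> \<phi> \<psi> \<eta> h g u)) \<partial>lborel)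
      \<le> (\<integral>\<^sup>+u. ennreal ?c * abs_wconv \<alpha> \<rho> \<phi> \<psi> \<eta> h g u \<partial>lborel)"
    by (intro nn_integral_mono norm_wconv_le[OF borel adm])
  also have "\<dots> = ennreal ?c * (\<integral>\<^sup>+u. abs_wconv \<alpha> \<rho> \<phi> \<psi> \<eta> h g u \<partial>lborel)"
    by (rule nn_integral_cmult) (simp add: measurable_abs_wconv[OF borel])
  also have "\<dots> \<le> ennreal ?c * ennreal (Lp_norm 1 \<phi> * ?A1 * ?A2)"
    by (intro mult_left_mono T) auto
  also have "\<dots> = ennreal (?c * (Lp_norm 1 \<phi> * ?A1 * ?A2))"
    using adm by (simp add: ennreal_mult')
  finally have W: "(\<integral>\<^sup>+u. ennreal (norm (wconv \<alpha> \<rho> \<phi> \<psi> \<eta> h g u)) \<partial>lborel)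
      \<le> ennreal (?c * (Lp_norm 1 \<phi> * ?A1 * ?A2))" .
  have int: "integrable lborel (wconv \<alpha> \<rho> \<phi> \<psi> \<eta> h g)"
    using order.strict_trans1[OF W] by (intro integrableI_bounded) auto
  then show "wconv \<alpha> \<rho> \<phi> \<psi> \<eta> h g \<in> Lp_space 1"
    by (simp add: Lp_space_lborel[OF wm])
  have "ennreal (Lp_norm 1 (wconv \<alpha> \<rho> \<phi> \<psi> \<eta> h g))
      = (\<integral>\<^sup>+u. ennreal (norm (wconv \<alpha> \<rho> \<phi> \<psi> \<eta> h g u)) \<partial>lborel)"
    using int by (simp add: Lp_space_lborel[OF wm] nn_integral_eq_integral)
  also note W
  finally have "Lp_norm 1 (wconv \<alpha> \<rho> \<phi> \<psi> \<eta> h g) \<le> ?c * (Lp_norm 1 \<phi> * ?A1 * ?A2)"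
    using adm hls Lpn by (subst (asm) ennreal_le_iff) auto
  then show "Lp_norm 1 (wconv \<alpha> \<rho> \<phi> \<psi> \<eta> h g)
      \<le> ?c * (hls_const (1 - \<rho>) p q * hls_const \<rho> r r')
        * Lp_norm 1 \<phi> * Lp_norm p \<psi> * Lp_norm q \<eta> * Lp_norm r' g * Lp_norm r h"
    by (simp add: mult_ac)
qed

text \<open>Convergence, the convolution, C_\<phi> and the norms are all unaffected by changing the
  data on null sets, so Borel representatives suffice.\<close>

lemma wconv_bound:
  fixes \<phi> \<psi> \<eta> h g :: "real \<Rightarrow> complex"
  assumes pq: "1 < p" "1 < q" "0 < \<rho>" "\<rho> < 1" "1 / p + 1 / q = \<rho> + 1"
    and rr: "1 < r" "1 < r'" "1 / r + 1 / r' + \<rho> = 2"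
    and Lp: "\<phi> \<in> Lp_space 1" "\<psi> \<in> Lp_space p" "\<eta> \<in> Lp_space q" "h \<in> Lp_space r" "g \<in> Lp_space r'"
    and adm: "0 < admissibility_const \<phi>"
  shows "(AE u in lebesgue. wconv_converges \<alpha> \<rho> \<phi> \<psi> \<eta> h g u) \<and>
    wconv \<alpha> \<rho> \<phi> \<psi> \<eta> h g \<in> Lp_space 1 \<and>
    Lp_norm 1 (wconv \<alpha> \<rho> \<phi> \<psi> \<eta> h g)
      \<le> inverse (admissibility_const \<phi>) * (hls_const (1 - \<rho>) p q * hls_const \<rho> r r')
        * Lp_norm 1 \<phi> * Lp_norm p \<psi> * Lp_norm q \<eta> * Lp_norm r' g * Lp_norm r h"
proof -
  have meas: "f \<in> borel_measurable lebesgue" if "f \<in> Lp_space s" for f s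
    using that by (simp add: Lp_space_def)
  obtain \<phi>' where \<phi>': "\<phi>' \<in> borel_measurable borel" "AE x in lborel. \<phi> x = \<phi>' x"
    using borel_representative[OF meas[OF Lp(1)]] .
  obtain \<psi>' where \<psi>': "\<psi>' \<in> borel_measurable borel" "AE x in lborel. \<psi> x = \<psi>' x"
    using borel_representative[OF meas[OF Lp(2)]] .
  obtain \<eta>' where \<eta>': "\<eta>' \<in> borel_measurable borel" "AE x in lborel. \<eta> x = \<eta>' x"
    using borel_representative[OF meas[OF Lp(3)]] .
  obtain h' where h': "h' \<in> borel_measurable borel" "AE x in lborel. h x = h' x"
    using borel_representative[OF meas[OF Lp(4)]] .
  obtain g' where g': "g' \<in> borel_measurable borel" "AE x in lborel. g x = g' x"
    using borel_representative[OF meas[OF Lp(5)]] .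
  note borel' = \<phi>'(1) \<psi>'(1) \<eta>'(1)
  note ae = \<phi>'(2) \<psi>'(2) \<eta>'(2)
  note wconv_eq = wconv_cong[OF borel' ae h'(1) g'(1) h'(2) g'(2)]
  note conv_eq = wconv_converges_cong[OF borel' ae h'(1) g'(1) h'(2) g'(2)]
  note C_eq = admissibility_const_cong[OF borel' ae]
  note Lp' = Lp_cong_AE(2)[OF \<phi>' Lp(1)] Lp_cong_AE(2)[OF \<psi>' Lp(2)] Lp_cong_AE(2)[OF \<eta>' Lp(3)]
    Lp_cong_AE(2)[OF h' Lp(4)] Lp_cong_AE(2)[OF g' Lp(5)]
  have adm': "0 < admissibility_const \<phi>'" using adm by (simp add: C_eq)
  note bound = wconv_bound_borel[OF borel' h'(1) g'(1) pq rr Lp' adm', of \<alpha>]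
  show ?thesis
    using bound
    by (simp add: wconv_eq conv_eq C_eq Lp_cong_AE(1)[OF \<phi>'] Lp_cong_AE(1)[OF \<psi>']
        Lp_cong_AE(1)[OF \<eta>'] Lp_cong_AE(1)[OF h'] Lp_cong_AE(1)[OF g'])
qed

theorem theorem3p5:
  "\<exists>C :: real \<Rightarrow> real \<Rightarrow> real \<Rightarrow> real.
     \<forall>(\<rho>::real) (p::real) (q::real) (r::real) (r'::real) (\<alpha>::real)
       (\<phi> :: real \<Rightarrow> complex) (\<psi> :: real \<Rightarrow> complex) (\<eta> :: real \<Rightarrow> complex)
       (h :: real \<Rightarrow> complex) (g :: real \<Rightarrow> complex).
       1 < p \<longrightarrow> 1 < q \<longrightarrow> 0 < \<rho> \<longrightarrow> \<rho> < 1 \<longrightarrow> 1 / p + 1 / q = \<rho> + 1 \<longrightarrow>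
       1 < r \<longrightarrow> 1 < r' \<longrightarrow> 1 / r + 1 / r' + \<rho> = 2 \<longrightarrow>
       sin (\<alpha> * pi / 2) \<noteq> 0 \<longrightarrow>
       \<phi> \<in> Lp_space 1 \<longrightarrow> \<psi> \<in> Lp_space p \<longrightarrow> \<eta> \<in> Lp_space q \<longrightarrow> admissible \<phi> \<longrightarrow>
       h \<in> Lp_space r \<longrightarrow> g \<in> Lp_space r' \<longrightarrow>
       (AE u in lebesgue. wconv_converges \<alpha> \<rho> \<phi> \<psi> \<eta> h g u) \<and>
       wconv \<alpha> \<rho> \<phi> \<psi> \<eta> h g \<in> Lp_space 1 \<and>
       Lp_norm 1 (wconv \<alpha> \<rho> \<phi> \<psi> \<eta> h g)
         \<le> inverse (admissibility_const \<phi>) * C \<rho> p r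
            * Lp_norm 1 \<phi> * Lp_norm p \<psi> * Lp_norm q \<eta> * Lp_norm r' g * Lp_norm r h"
\<comment> \<open>The bound involves q and r' as well, but the exponent relations determine them
  from \<rho>, p and r; the witness substitutes these solutions.\<close>
proof (intro exI[of _ "\<lambda>\<rho> p r. hls_const (1 - \<rho>) p (1 / (\<rho> + 1 - 1 / p))
      * hls_const \<rho> r (1 / (2 - \<rho> - 1 / r))"] allI impI)
  fix \<rho> p q r r' \<alpha> :: real and \<phi> \<psi> \<eta> h g :: "real \<Rightarrow> complex"
  assume *: "1 < p" "1 < q" "0 < \<rho>" "\<rho> < 1" "1 / p + 1 / q = \<rho> + 1"
    "1 < r" "1 < r'" "1 / r + 1 / r' + \<rho> = 2"
    "\<phi> \<in> Lp_space 1" "\<psi> \<in> Lp_space p" "\<eta> \<in> Lp_space q"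
    "admissible \<phi>" "h \<in> Lp_space r" "g \<in> Lp_space r'"
  have "\<rho> + 1 - 1 / p = 1 / q" "2 - \<rho> - 1 / r = 1 / r'" using * by linarith+
  then have exponents: "1 / (\<rho> + 1 - 1 / p) = q" "1 / (2 - \<rho> - 1 / r) = r'" by simp_all
  have "0 < admissibility_const \<phi>" using * by (simp add: admissible_def)
  with * show "(AE u in lebesgue. wconv_converges \<alpha> \<rho> \<phi> \<psi> \<eta> h g u) \<and>
       wconv \<alpha> \<rho> \<phi> \<psi> \<eta> h g \<in> Lp_space 1 \<and>
       Lp_norm 1 (wconv \<alpha> \<rho> \<phi> \<psi> \<eta> h g)
         \<le> inverse (admissibility_const \<phi>) * (hls_const (1 - \<rho>) p (1 / (\<rho> + 1 - 1 / p))
              * hls_const \<rho> r (1 / (2 - \<rho> - 1 / r)))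
            * Lp_norm 1 \<phi> * Lp_norm p \<psi> * Lp_norm q \<eta> * Lp_norm r' g * Lp_norm r h"
    unfolding exponents by (intro wconv_bound)
qed

end
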